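(* Let $n\ge 1$, let $z_1,\dots,z_n\in\mathbb{R}^3$ be pairwise distinct, and let $\alpha_1,\dots,\alpha_n\in\mathbb{R}$. Let $A$ be the $n\times n$ matrix with entries $$A_{j,j}=\alpha_j,\qquad A_{j,j'}=-\frac{1}{4\pi|z_j-z_{j'}|}\ \ (j'\neq j).$$ Call $\psi\in L^2(\mathbb{R}^3)$ a zero-energy bound state if $\Delta\psi(x)=0$ for $x\in\mathbb{R}^3\setminus\{z_1,\dots,z_n\}$ and, for each $j=1,\dots,n$, there are constants $\psi_{j,-1},\psi_{j,0}$ with $$\psi(x)=\frac{\psi_{j,-1}}{|x-z_j|}+\psi_{j,0}+O(|x-z_j|)\ \text{ as } x\to z_j,\qquad \psi_{j,0}=4\pi\alpha_j\psi_{j,-1}.$$ Then a non-zero zero-energy bound state exists if and only if there exists a non-zero vector $\vec q=(q_1,\dots,q_n)^t\in\mathbb{C}^n$ such that $$A\vec q=0\qquad\text{and}\qquad \sum_{j=1}^n q_j=0.$$ Moreover, the formula $$\psi(x)=-\frac{1}{4\pi}\sum_{j=1}^n \frac{q_j}{|x-z_j|}$$ gives a one-to-one correspondence between such vectors $\vec q$ and the zero-energy bound states $\psi$.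
   Context: A zero-energy bound state as defined in the claim is an $L^2(\mathbb{R}^3)$ solution at energy $E=0$ of the Schrödinger equation $-\Delta\psi+v\psi=E\psi$ with multipoint point-interaction potential $v=\sum_{j=1}^n v_{z_j,\alpha_j}$ (single-point scatterers at $z_j$ with internal parameters $\alpha_j$). The matrix $A$ is the matrix $A_{j,j}=\alpha_j-\frac{i\sqrt E}{4\pi}$, $A_{j,j'}=-\frac{e^{i\sqrt E|z_j-z_{j'}|}}{4\pi|z_j-z_{j'}|}$ evaluated at $E=0$. *)

theory Defs
  imports "HOL-Analysis.Analysis"
begin

definition A_mat :: "(nat \<Rightarrow> real^3) \<Rightarrow> (nat \<Rightarrow> real) \<Rightarrow> nat \<Rightarrow> nat \<Rightarrow> real" where
  "A_mat z \<alpha> j k = (if j = k then \<alpha> j else - 1 / (4 * pi * dist (z j) (z k)))"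

definition laplacian :: "(real^3 \<Rightarrow> complex) \<Rightarrow> real^3 \<Rightarrow> complex" where
  "laplacian f x = (\<Sum>i\<in>Basis. frechet_derivative (\<lambda>y. frechet_derivative f (at y) i) (at x) i)"

definition harmonic_on :: "(real^3) set \<Rightarrow> (real^3 \<Rightarrow> complex) \<Rightarrow> bool" where
  "harmonic_on S f \<longleftrightarrow>
     (\<forall>x\<in>S. f differentiable (at x)
        \<and> (\<forall>i\<in>Basis. (\<lambda>y. frechet_derivative f (at y) i) differentiable (at x))
        \<and> laplacian f x = 0)"

definition zero_energy_bound_state ::
  "nat \<Rightarrow> (nat \<Rightarrow> real^3) \<Rightarrow> (nat \<Rightarrow> real) \<Rightarrow> (real^3 \<Rightarrow> complex) \<Rightarrow> bool" where
  "zero_energy_bound_state n z \<alpha> \<psi> \<longleftrightarrow>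
     \<psi> \<in> borel_measurable lebesgue
   \<and> integrable lebesgue (\<lambda>x. (norm (\<psi> x))^2)
   \<and> harmonic_on (- (z ` {..<n})) \<psi>
   \<and> (\<forall>j<n. \<exists>c1 c0 :: complex. c0 = 4 * of_real pi * of_real (\<alpha> j) * c1
         \<and> (\<exists>C \<delta>::real. \<delta> > 0 \<and>
              (\<forall>x. 0 < dist x (z j) \<and> dist x (z j) < \<delta> \<longrightarrow>
                 norm (\<psi> x - c1 / of_real (dist x (z j)) - c0) \<le> C * dist x (z j))))"

text \<open>Vectors q in C^n are functions nat => complex vanishing at indices >= n.\<close>
definition admissible_vector ::
  "nat \<Rightarrow> (nat \<Rightarrow> real^3) \<Rightarrow> (nat \<Rightarrow> real) \<Rightarrow> (nat \<Rightarrow> complex) \<Rightarrow> bool" where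
  "admissible_vector n z \<alpha> q \<longleftrightarrow>
     (\<forall>j<n. (\<Sum>k<n. of_real (A_mat z \<alpha> j k) * q k) = 0) \<and> (\<Sum>j<n. q j) = 0"

definition psi_of :: "nat \<Rightarrow> (nat \<Rightarrow> real^3) \<Rightarrow> (nat \<Rightarrow> complex) \<Rightarrow> real^3 \<Rightarrow> complex" where
  "psi_of n z q x = - (1 / (4 * of_real pi)) * (\<Sum>j<n. q j / of_real (dist x (z j)))"

end

theory Submission
  imports Defs
begin

text \<open>Let \<open>\<psi>\<close> be a bound state with leading coefficients \<open>c\<^sub>j\<close> at \<open>z\<^sub>j\<close>. The difference
  \<open>h = \<psi> - \<Sum> c\<^sub>j / |x - z\<^sub>j|\<close> is harmonic off the \<open>z\<^sub>j\<close> and extends continuously to them. Harmonicity is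
  used only through second differences \<open>f (x + t e\<^sub>i) + f (x - t e\<^sub>i) - 2 f x\<close>; they suffice for the
  maximum principle and, unlike derivatives, need no regularity theory. Averages of \<open>h\<close> over
  translates of a fixed box tend to \<open>0\<close> at infinity because \<open>\<psi>\<close> is square integrable. They are
  locally uniform limits of finite Riemann sums of translates of \<open>h\<close>, and each such sum obeys a maximum
  principle with finitely many exceptional points. So all box averages vanish and \<open>h = 0\<close>. Comparing the
  constant terms at each \<open>z\<^sub>j\<close> gives \<open>A q = 0\<close> for \<open>q = - 4 \<pi> c\<close>, and the decay rate \<open>(\<Sum> c\<^sub>j) / |x|\<close> at
  infinity is square integrable only if \<open>\<Sum> q\<^sub>j = 0\<close>. Conversely, \<open>\<Sum> q\<^sub>j = 0\<close> turns the potential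
  into a combination of differences \<open>1 / |x - z\<^sub>j| - 1 / |x - z\<^sub>0|\<close>, which are \<open>O(|x|\<^sup>-\<^sup>2)\<close>.\<close>

subsection \<open>Second differences of harmonic functions\<close>

text \<open>The discrete Laplacian with step \<open>t\<close>. The codomain is a general normed
  space, since it is applied both to complex potentials and to real functions such as
  \<open>Re (w * H x)\<close>.\<close>

definition second_difference_sum ::
  "('a::euclidean_space \<Rightarrow> 'b::real_normed_vector) \<Rightarrow> 'a \<Rightarrow> real \<Rightarrow> 'b" where
  "second_difference_sum f x t =
     (\<Sum>i\<in>Basis. (f (x + t *\<^sub>R i) + f (x - t *\<^sub>R i) - 2 *\<^sub>R f x) /\<^sub>R t\<^sup>2)"

lemma second_difference_sum_linear:
  "second_difference_sum (\<lambda>y. f y + g y) x t = second_difference_sum f x t + second_difference_sum g x t"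
  "bounded_linear l \<Longrightarrow> second_difference_sum (\<lambda>y. l (f y)) x t = l (second_difference_sum f x t)"
proof -
  show "second_difference_sum (\<lambda>y. f y + g y) x t = second_difference_sum f x t + second_difference_sum g x t"
    unfolding second_difference_sum_def sum.distrib[symmetric]
    by (intro sum.cong refl) (simp add: algebra_simps)
  assume "bounded_linear l"
  then interpret bounded_linear l .
  show "second_difference_sum (\<lambda>y. l (f y)) x t = l (second_difference_sum f x t)"
    unfolding second_difference_sum_def by (simp add: sum scaleR diff add)
qed

lemma second_difference_sum_sum:
  "finite A \<Longrightarrow> second_difference_sum (\<lambda>y. \<Sum>k\<in>A. f k y) x t = (\<Sum>k\<in>A. second_difference_sum (f k) x t)"
  by (induction A rule: finite_induct)
     (simp_all add: second_difference_sum_linear, simp add: second_difference_sum_def)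

lemma second_difference_sum_cong:
  assumes "open S" "x \<in> S" "\<And>y. y \<in> S \<Longrightarrow> f y = g y"
  shows "\<forall>\<^sub>F t in at_right 0. second_difference_sum f x t = second_difference_sum g x t"
proof -
  obtain e where e: "e > 0" "ball x e \<subseteq> S" using assms openE by blast
  have "\<forall>\<^sub>F t in at_right (0::real). 0 < t \<and> t < e"
    using e(1) by (auto simp: eventually_at_right_field)
  thus ?thesis
  proof eventually_elim
    case (elim t)
    have "x + t *\<^sub>R i \<in> S" "x - t *\<^sub>R i \<in> S" if "i \<in> Basis" for i
      using e elim that by (auto simp: dist_norm subset_iff)
    thus ?case unfolding second_difference_sum_def using assms by auto
  qed
qed

text \<open>Parallelogram law: each of the coordinate directions contributes exactly 2, for every
  nonzero step.\<close>

lemma second_difference_sum_norm_sq: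
  fixes x :: "'a::euclidean_space"
  assumes "t \<noteq> 0"
  shows "second_difference_sum (\<lambda>y. (norm y)\<^sup>2) x t = 2 * real DIM('a)"
proof -
  have "((norm (x + t *\<^sub>R i))\<^sup>2 + (norm (x - t *\<^sub>R i))\<^sup>2 - 2 *\<^sub>R (norm x)\<^sup>2) /\<^sub>R t\<^sup>2 = 2" if "i \<in> Basis" for i
    using that assms unfolding power2_norm_eq_inner
    by (simp add: inner_simps inner_commute field_simps power2_eq_square del: norm_eq_sqrt_inner)
  thus ?thesis unfolding second_difference_sum_def by simp
qed

text \<open>As soon as the step is small enough for both neighbours \<open>x + t i\<close> and
  \<open>x - t i\<close> to lie in \<open>S\<close>, each summand is nonpositive, and the sign
  passes to the limit.\<close>

lemma second_difference_local_max:
  fixes w :: "'a::euclidean_space \<Rightarrow> real"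
  assumes lim: "(second_difference_sum w x \<longlongrightarrow> L) (at_right 0)"
    and "open S" "x \<in> S" "\<And>y. y \<in> S \<Longrightarrow> w y \<le> w x"
  shows "L \<le> 0"
proof -
  obtain e where e: "e > 0" "ball x e \<subseteq> S" using assms openE by blast
  have "\<forall>\<^sub>F t in at_right (0::real). 0 < t \<and> t < e"
    using e(1) by (auto simp: eventually_at_right_field)
  hence "\<forall>\<^sub>F t in at_right 0. second_difference_sum w x t \<le> 0"
  proof eventually_elim
    case (elim t)
    have "x + t *\<^sub>R i \<in> S" "x - t *\<^sub>R i \<in> S" if "i \<in> Basis" for i
      using e elim that by (auto simp: dist_norm subset_iff)
    hence "w (x + t *\<^sub>R i) + w (x - t *\<^sub>R i) - 2 *\<^sub>R w x \<le> 0" if "i \<in> Basis" for i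
      using assms(4)[of "x + t *\<^sub>R i"] assms(4)[of "x - t *\<^sub>R i"] that by fastforce
    thus ?case unfolding second_difference_sum_def
      by (intro sum_nonpos) (simp add: mult_nonneg_nonpos)
  qed
  from tendsto_upperbound[OF lim this] show ?thesis by simp
qed

text \<open>L'Hopital is applied once only, because \<open>g'\<close> is known to be differentiable
  merely at 0. The resulting quotient \<open>(g' t - g' (- t)) / (2 * t)\<close> is the mean of the
  two difference quotients of \<open>g'\<close> at 0 with steps \<open>t\<close> and
  \<open>- t\<close>, so it tends to \<open>D\<close>.\<close>

lemma second_difference_limit_real:
  fixes g g' :: "real \<Rightarrow> real"
  assumes "e > 0" "\<And>t. \<bar>t\<bar> < e \<Longrightarrow> (g has_real_derivative g' t) (at t)"
    and "(g' has_real_derivative D) (at 0)"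
  shows "((\<lambda>t. (g t + g (- t) - 2 * g 0) / t\<^sup>2) \<longlongrightarrow> D) (at_right 0)"
proof (rule lhopital_right_0)
  have c: "isCont g 0" using assms(1) assms(2)[of 0] DERIV_isCont by auto
  have "((\<lambda>t. g t + g (- t) - 2 * g 0) \<longlongrightarrow> g 0 + g 0 - 2 * g 0) (at_right 0)"
    by (intro tendsto_intros isCont_tendsto_compose[OF c] tendsto_eq_intros) (auto intro!: tendsto_eq_intros)
  thus "((\<lambda>t. g t + g (- t) - 2 * g 0) \<longlongrightarrow> 0) (at_right 0)" by simp
  show "((\<lambda>t::real. t\<^sup>2) \<longlongrightarrow> 0) (at_right 0)" by (auto intro!: tendsto_eq_intros)
  have ev: "\<forall>\<^sub>F t in at_right (0::real). 0 < t \<and> t < e"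
    using assms(1) by (auto simp: eventually_at_right_field)
  show "\<forall>\<^sub>F t in at_right (0::real). t\<^sup>2 \<noteq> 0" using ev by eventually_elim auto
  show "\<forall>\<^sub>F t in at_right (0::real). 2 * t \<noteq> 0" using ev by eventually_elim auto
  show "\<forall>\<^sub>F t in at_right (0::real). ((\<lambda>t. t\<^sup>2) has_real_derivative 2 * t) (at t)"
    by (intro always_eventually allI) (auto intro!: derivative_eq_intros)
  show "\<forall>\<^sub>F t in at_right 0. ((\<lambda>t. g t + g (- t) - 2 * g 0) has_real_derivative g' t - g' (- t)) (at t)"
    using ev
  proof eventually_elim
    case (elim t)
    have "((\<lambda>t. g (- t)) has_real_derivative g' (- t) * (- 1)) (at t)"
      by (rule DERIV_chain2[where f=g, OF assms(2)]) (use elim in \<open>auto intro!: derivative_eq_intros\<close>)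
    with assms(2)[of t] elim show ?case by (auto intro!: derivative_eq_intros)
  qed
  have 1: "((\<lambda>t. (g' t - g' 0) / t) \<longlongrightarrow> D) (at 0)"
    using assms(3) by (simp add: has_field_derivative_iff)
  have 2: "((\<lambda>t. (g' (- t) - g' 0) / (- t)) \<longlongrightarrow> D) (at 0)"
    by (rule filterlim_compose[OF 1]) (auto simp: filterlim_at eventually_at_filter intro!: tendsto_eq_intros)
  have "((\<lambda>t. ((g' t - g' 0) / t + (g' (- t) - g' 0) / (- t)) / 2) \<longlongrightarrow> (D + D) / 2) (at 0)"
    by (intro tendsto_intros 1 2) simp
  hence "((\<lambda>t. ((g' t - g' 0) / t + (g' (- t) - g' 0) / (- t)) / 2) \<longlongrightarrow> D) (at_right 0)"
    by (simp add: filterlim_at_split)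
  moreover have "((g' t - g' 0) / t + (g' (- t) - g' 0) / (- t)) / 2 = (g' t - g' (- t)) / (2 * t)" for t
    by (cases "t = 0") (auto simp: field_simps)
  ultimately show "((\<lambda>t. (g' t - g' (- t)) / (2 * t)) \<longlongrightarrow> D) (at_right 0)" by (simp only:)
qed

text \<open>Restricting \<open>f\<close> to the line through \<open>x\<close> in a basis direction
  reduces the claim to one real variable; summing the limits over the directions gives the
  Laplacian, which vanishes.\<close>

lemma second_difference_harmonic:
  assumes "harmonic_on S f" "open S" "x \<in> S"
  shows "(second_difference_sum f x \<longlongrightarrow> 0) (at_right 0)"
proof -
  obtain e where e: "e > 0" "ball x e \<subseteq> S" using assms openE by blast
  define P where "P i y = frechet_derivative f (at y) i" for i y
  have one: "((\<lambda>t. (f (x + t *\<^sub>R i) + f (x - t *\<^sub>R i) - 2 *\<^sub>R f x) /\<^sub>R t\<^sup>2)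
      \<longlongrightarrow> frechet_derivative (P i) (at x) i) (at_right 0)" if i: "i \<in> Basis" for i
  proof -
    have line: "((\<lambda>t. x + t *\<^sub>R i) has_derivative (\<lambda>t. t *\<^sub>R i)) (at t)" for t
      by (auto intro!: derivative_eq_intros)
    have fd: "((\<lambda>t. f (x + t *\<^sub>R i)) has_vector_derivative P i (x + t *\<^sub>R i)) (at t)" if t: "\<bar>t\<bar> < e" for t
    proof -
      have "x + t *\<^sub>R i \<in> S" using t e i by (auto simp: dist_norm subset_iff)
      hence "(f has_derivative frechet_derivative f (at (x + t *\<^sub>R i))) (at (x + t *\<^sub>R i))"
        using assms(1) by (auto simp: harmonic_on_def frechet_derivative_works[symmetric])
      from has_derivative_compose[OF line this] show ?thesis
        unfolding has_vector_derivative_def P_def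
        using linear_scale[OF has_derivative_linear[OF \<open>(f has_derivative frechet_derivative f (at (x + t *\<^sub>R i))) (at (x + t *\<^sub>R i))\<close>]]
        by simp
    qed
    have pd: "((\<lambda>t. P i (x + t *\<^sub>R i)) has_vector_derivative frechet_derivative (P i) (at x) i) (at 0)"
    proof -
      have d: "(P i has_derivative frechet_derivative (P i) (at x)) (at x)"
        using assms(1,3) i by (auto simp: harmonic_on_def frechet_derivative_works[symmetric] P_def[abs_def])
      hence "(P i has_derivative frechet_derivative (P i) (at x)) (at (x + 0 *\<^sub>R i))" by simp
      from has_derivative_compose[OF line this] show ?thesis
        unfolding has_vector_derivative_def
        using linear_scale[OF has_derivative_linear[OF d]] by simp
    qed
    \<comment> \<open>The one-variable limit is about real functions, so it is used through a real
      linear functional \<open>l\<close>, later \<open>Re\<close> and \<open>Im\<close>.\<close>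
    have comp: "((\<lambda>t. l ((f (x + t *\<^sub>R i) + f (x - t *\<^sub>R i) - 2 *\<^sub>R f x) /\<^sub>R t\<^sup>2))
      \<longlongrightarrow> l (frechet_derivative (P i) (at x) i)) (at_right 0)" if l: "bounded_linear l" for l :: "complex \<Rightarrow> real"
    proof -
      interpret bounded_linear l by (rule l)
      have "((\<lambda>t. (l (f (x + t *\<^sub>R i)) + l (f (x + (- t) *\<^sub>R i)) - 2 * l (f (x + 0 *\<^sub>R i))) / t\<^sup>2) \<longlongrightarrow> l (frechet_derivative (P i) (at x) i)) (at_right 0)"
        by (rule second_difference_limit_real[OF e(1), where g'="\<lambda>t. l (P i (x + t *\<^sub>R i))"])
           (auto simp: has_real_derivative_iff_has_vector_derivative intro!: has_vector_derivative fd pd)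
      thus ?thesis by (simp add: add diff scaleR divide_inverse mult.commute)
    qed
    show ?thesis unfolding tendsto_complex_iff
      using comp[OF bounded_linear_Re] comp[OF bounded_linear_Im] by blast
  qed
  have "((\<lambda>t. \<Sum>i\<in>Basis. (f (x + t *\<^sub>R i) + f (x - t *\<^sub>R i) - 2 *\<^sub>R f x) /\<^sub>R t\<^sup>2)
      \<longlongrightarrow> (\<Sum>i\<in>Basis. frechet_derivative (P i) (at x) i)) (at_right 0)"
    by (intro tendsto_sum one)
  moreover have "(\<Sum>i\<in>Basis. frechet_derivative (P i) (at x) i) = 0"
    using assms(1,3) unfolding harmonic_on_def laplacian_def P_def[abs_def] by simp
  ultimately show ?thesis unfolding second_difference_sum_def[abs_def] by simp
qed

text \<open>Lets harmonicity be proved from explicit derivatives: uniqueness identifies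
  \<open>frechet_derivative\<close> with \<open>f'\<close> throughout the open set \<open>S\<close>,
  so both functions have the same derivative there.\<close>

lemma harmonic_onI:
  assumes "open S" "\<And>y. y \<in> S \<Longrightarrow> (f has_derivative f' y) (at y)"
    and "\<And>y i. y \<in> S \<Longrightarrow> i \<in> Basis \<Longrightarrow> ((\<lambda>y. f' y i) has_derivative f'' y i) (at y)"
    and "\<And>y. y \<in> S \<Longrightarrow> (\<Sum>i\<in>Basis. f'' y i i) = 0"
  shows "harmonic_on S f"
  unfolding harmonic_on_def
proof (intro ballI conjI)
  fix x assume x: "x \<in> S"
  show "f differentiable at x" using assms(2)[OF x] by (auto simp: differentiable_def)
  have d: "((\<lambda>y. frechet_derivative f (at y) i) has_derivative f'' x i) (at x)" if "i \<in> Basis" for i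
    by (rule has_derivative_transform_within_open[OF assms(3)[OF x that] assms(1) x])
       (simp add: frechet_derivative_at[OF assms(2)])
  thus "(\<lambda>y. frechet_derivative f (at y) i) differentiable at x" if "i \<in> Basis" for i
    using that by (auto simp: differentiable_def)
  show "laplacian f x = 0" unfolding laplacian_def
    using assms(4)[OF x] by (simp add: frechet_derivative_at[OF d, symmetric])
qed

lemma harmonic_on_sum:
  assumes "finite A" "open S" "\<And>k. k \<in> A \<Longrightarrow> harmonic_on S (f k)"
  shows "harmonic_on S (\<lambda>x. \<Sum>k\<in>A. c k * f k x)"
proof -
  let ?P = "\<lambda>k i y. frechet_derivative (f k) (at y) i"
  show ?thesis
  proof (rule harmonic_onI[OF assms(2), where f'="\<lambda>y h. \<Sum>k\<in>A. c k * ?P k h y"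
     and f''="\<lambda>y i h. \<Sum>k\<in>A. c k * frechet_derivative (?P k i) (at y) h"])
    fix y i assume y: "y \<in> S"
    show "((\<lambda>x. \<Sum>k\<in>A. c k * f k x) has_derivative (\<lambda>h. \<Sum>k\<in>A. c k * ?P k h y)) (at y)"
      using assms(3) y
      by (intro has_derivative_sum has_derivative_mult_right)
         (auto simp: harmonic_on_def frechet_derivative_works)
    show "((\<lambda>y. \<Sum>k\<in>A. c k * ?P k i y) has_derivative (\<lambda>h. \<Sum>k\<in>A. c k * frechet_derivative (?P k i) (at y) h)) (at y)"
      if "i \<in> Basis"
      using assms(3) y that
      by (intro has_derivative_sum has_derivative_mult_right)
         (auto simp: harmonic_on_def frechet_derivative_works)
    show "(\<Sum>i\<in>Basis. \<Sum>k\<in>A. c k * frechet_derivative (?P k i) (at y) i) = 0"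
      using assms(3) y
      by (subst sum.swap) (auto simp: sum_distrib_left[symmetric] harmonic_on_def laplacian_def)
  qed
qed

text \<open>With \<open>r = norm (y - a)\<close>, the trace of the Hessian is
  \<open>- 3 / r ^ 3 + 3 * r ^ 2 / r ^ 5 = 0\<close>; the first 3 is the dimension of the
  space.\<close>

lemma harmonic_on_inverse_dist:
  "harmonic_on (- {a}) (\<lambda>x. 1 / of_real (dist x a))"
proof -
  define f' where "f' y h = complex_of_real (- ((y - a) \<bullet> h) / norm (y - a) ^ 3)" for y h :: "real^3"
  define f'' where "f'' y i h = complex_of_real (- (h \<bullet> i) / norm (y - a) ^ 3
       + 3 * ((y - a) \<bullet> i) * ((y - a) \<bullet> h) / norm (y - a) ^ 5)" for y i h :: "real^3"
  show ?thesis
  proof (rule harmonic_onI[where f'=f' and f''=f''])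
    show "open (- {a})" by (simp add: open_Compl)
    fix y i :: "real^3" assume "y \<in> - {a}"
    hence n: "norm (y - a) > 0" "y \<noteq> a" by auto
    have "((\<lambda>x. norm (x - a)) has_derivative (\<lambda>h. h \<bullet> sgn (y - a))) (at y)"
      by (rule has_derivative_compose[where g=norm and f="\<lambda>x. x - a" and f'="\<lambda>h. h"])
         (use n in \<open>auto intro!: derivative_eq_intros has_derivative_norm\<close>)
    hence nd: "((\<lambda>x. norm (x - a)) has_derivative (\<lambda>h. ((y - a) \<bullet> h) / norm (y - a))) (at y)"
      by (simp add: sgn_div_norm inner_commute divide_inverse mult.commute)
    have "((\<lambda>x. 1 / dist x a) has_derivative (\<lambda>h. - ((y - a) \<bullet> h) / norm (y - a) ^ 3)) (at y)"
      unfolding dist_norm using n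
      by (auto intro!: derivative_eq_intros nd simp: inner_simps field_simps power3_eq_cube power2_eq_square fun_eq_iff inner_commute)
    hence "((\<lambda>x. complex_of_real (1 / dist x a)) has_derivative f' y) (at y)"
      unfolding f'_def by (rule has_derivative_of_real)
    thus "((\<lambda>x. 1 / of_real (dist x a)) has_derivative f' y) (at y)"
      by simp
    have "((\<lambda>y. - ((y - a) \<bullet> i) / norm (y - a) ^ 3) has_derivative (\<lambda>h. - (h \<bullet> i) / norm (y - a) ^ 3
       + 3 * ((y - a) \<bullet> i) * ((y - a) \<bullet> h) / norm (y - a) ^ 5)) (at y)"
      using n
      by (auto intro!: derivative_eq_intros nd simp: inner_simps field_simps power_numeral_reduce fun_eq_iff inner_commute)
    thus "((\<lambda>y. f' y i) has_derivative f'' y i) (at y)"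
      unfolding f'_def f''_def by (rule has_derivative_of_real)
    have "(\<Sum>i\<in>Basis. ((y - a) \<bullet> i) * ((y - a) \<bullet> i)) = (norm (y - a))\<^sup>2"
      unfolding power2_norm_eq_inner by (rule euclidean_inner[symmetric])
    hence "(\<Sum>i\<in>Basis. - (i \<bullet> i) / norm (y - a) ^ 3
       + 3 * ((y - a) \<bullet> i) * ((y - a) \<bullet> i) / norm (y - a) ^ 5) = - 3 / norm (y - a) ^ 3 + 3 * (norm (y - a))\<^sup>2 / norm (y - a) ^ 5"
      by (simp add: sum_subtractf sum_divide_distrib[symmetric] sum_distrib_left[symmetric] mult.assoc)
    also have "\<dots> = 0" using n by (simp add: field_simps power_numeral_reduce)
    finally show "(\<Sum>i\<in>Basis. f'' y i i) = 0" unfolding f''_def of_real_sum[symmetric] by (simp only: of_real_0)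
  qed
qed

subsection \<open>A Liouville theorem with finitely many exceptional points\<close>

lemma second_difference_dist:
  assumes "x \<noteq> a"
  shows "(second_difference_sum (\<lambda>x::real^3. 1 / dist x a) x \<longlongrightarrow> 0) (at_right 0)"
proof -
  have "(second_difference_sum (\<lambda>x. 1 / complex_of_real (dist x a)) x \<longlongrightarrow> 0) (at_right 0)"
    by (rule second_difference_harmonic[OF harmonic_on_inverse_dist[of a]]) (use assms in \<open>auto simp: open_Compl\<close>)
  from tendsto_Re[OF this] show ?thesis
    by (simp add: second_difference_sum_linear(2)[OF bounded_linear_Re, symmetric])
qed

text \<open>The barrier \<open>\<epsilon> \<Sum> 1 / dist x s\<close> makes the finite exceptional set invisible, and the
  perturbation \<open>\<eta> |x|\<^sup>2\<close> makes the second differences strictly positive at an interior maximum.\<close>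
lemma maximum_principle_punctured:
  fixes u :: "real^3 \<Rightarrow> real"
  assumes cont: "continuous_on (cball 0 R) u" and S: "finite S"
    and harm: "\<And>x. x \<in> ball 0 R - S \<Longrightarrow> (second_difference_sum u x \<longlongrightarrow> 0) (at_right 0)"
    and bd: "\<And>x. x \<in> sphere 0 R \<Longrightarrow> u x \<le> M"
    and x0: "x0 \<in> cball 0 R"
  shows "u x0 \<le> M"
proof (rule ccontr)
  assume "\<not> u x0 \<le> M"
  hence gt: "u x0 > M" by simp
  hence x0b: "x0 \<in> ball 0 R" using x0 bd[of x0] by (cases "norm x0 = R") auto
  hence Rpos: "R > 0" by (smt (verit) mem_ball_0 norm_ge_zero)
  have cb: "continuous_on (ball 0 R) u" using cont by (rule continuous_on_subset) auto
  \<comment> \<open>The comparison has to start from a point off \<open>S\<close>, where the barrier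
    can be made small. A nonempty open set is infinite, so a point \<open>x1\<close> with
    \<open>u x1 > M\<close> exists outside the finite set \<open>S\<close>.\<close>
  have "open (ball 0 R \<inter> u -` {M<..})"
    using continuous_on_open_vimage[of "ball 0 R" u] cb by (auto simp: Int_commute)
  moreover have "x0 \<in> ball 0 R \<inter> u -` {M<..}" using gt x0b by auto
  ultimately have "infinite (ball 0 R \<inter> u -` {M<..})"
    using open_not_negligible negligible_finite by blast
  hence "\<exists>x. x \<in> (ball 0 R \<inter> u -` {M<..}) - S"
    using S by (metis Diff_infinite_finite finite.emptyI ex_in_conv)
  then obtain x1 where x1: "x1 \<in> ball 0 R" "u x1 > M" "x1 \<notin> S" by auto
  define B where "B x = (\<Sum>s\<in>S. 1 / dist x s)" for x
  have Bnn: "B x \<ge> 0" for x unfolding B_def by (auto intro!: sum_nonneg)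
  \<comment> \<open>The excess of \<open>u x1\<close> over \<open>M\<close> pays for both
    perturbations: \<open>\<epsilon>\<close> and \<open>\<eta>\<close> are chosen so that each costs
    less than half of it.\<close>
  define \<gamma> where "\<gamma> = u x1 - M"
  have g: "\<gamma> > 0" using x1 \<gamma>_def by simp
  define \<epsilon> where "\<epsilon> = \<gamma> / (4 * (B x1 + 1))"
  have eps: "\<epsilon> > 0" "\<epsilon> * B x1 < \<gamma> / 2"
    using g Bnn[of x1] by (auto simp: \<epsilon>_def field_simps add_pos_nonneg)
  define \<eta> where "\<eta> = \<gamma> / (4 * R\<^sup>2)"
  have eta: "\<eta> > 0" "\<eta> * R\<^sup>2 < \<gamma> / 2"
    using g Rpos by (auto simp: \<eta>_def field_simps)
  define w where "w x = (u x + (- \<epsilon>) * B x) + \<eta> * (norm x)\<^sup>2" for x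
  have etaR: "\<eta> * (norm x)\<^sup>2 \<le> \<eta> * R\<^sup>2" if "x \<in> cball 0 R" for x
    using that eta by (intro mult_left_mono power_mono) auto
  have "bdd_above (u ` cball 0 R)"
    by (intro bounded_imp_bdd_above compact_imp_bounded compact_continuous_image cont compact_cball)
  then obtain K0 where K0: "\<And>x. x \<in> cball 0 R \<Longrightarrow> u x \<le> K0" unfolding bdd_above_def by blast
  define K where "K = max K0 (M + 1)"
  have K: "\<And>x. x \<in> cball 0 R \<Longrightarrow> u x \<le> K" "K > M" using K0 by (auto simp: K_def le_max_iff_disj)
  \<comment> \<open>Half of the minimum makes two inequalities strict: the balls of radius
    \<open>\<rho>\<close> about \<open>S\<close> miss \<open>x1\<close>, and
    \<open>\<epsilon> / \<rho>\<close> exceeds \<open>K - M\<close>, so the barrier beats the upper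
    bound \<open>K\<close> of \<open>u\<close> inside them.\<close>
  define \<rho> where "\<rho> = Min (insert (\<epsilon> / (K - M)) (dist x1 ` S)) / 2"
  have rho: "\<rho> > 0" "\<rho> < \<epsilon> / (K - M)" "\<And>s. s \<in> S \<Longrightarrow> \<rho> < dist x1 s"
  proof -
    let ?m = "Min (insert (\<epsilon> / (K - M)) (dist x1 ` S))"
    have m: "?m > 0" using S eps K x1 by (subst Min_gr_iff) auto
    thus "\<rho> > 0" by (simp add: \<rho>_def)
    have "?m \<le> \<epsilon> / (K - M)" using S by (intro Min_le) auto
    thus "\<rho> < \<epsilon> / (K - M)" using m unfolding \<rho>_def by linarith
    fix s assume "s \<in> S"
    hence "?m \<le> dist x1 s" using S by (intro Min_le) auto
    thus "\<rho> < dist x1 s" using m unfolding \<rho>_def by linarith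
  qed
  define C where "C = cball 0 R - (\<Union>s\<in>S. ball s \<rho>)"
  have "compact C" unfolding C_def using S by (intro compact_diff) auto
  moreover have "x1 \<in> C" using x1 rho(3) by (force simp: C_def dist_commute)
  moreover have CS: "x \<notin> S" if "x \<in> C" for x using that rho(1) by (auto simp: C_def)
  hence "continuous_on C w" unfolding w_def B_def
    by (intro continuous_intros continuous_on_subset[OF cont]) (auto simp: C_def)
  ultimately obtain y where y: "y \<in> C" "\<And>x. x \<in> C \<Longrightarrow> w x \<le> w y"
    using continuous_attains_sup[of C w] by blast
  have "w x1 > M + \<eta> * R\<^sup>2"
  proof -
    have "w x1 \<ge> u x1 - \<epsilon> * B x1" using eta by (simp add: w_def)
    thus ?thesis using eps(2) eta(2) \<gamma>_def by simp
  qed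
  hence wy: "w y > M + \<eta> * R\<^sup>2" using y(2)[OF \<open>x1 \<in> C\<close>] by simp
  have yb: "y \<in> cball 0 R" using y by (auto simp: C_def)
  have "w y \<le> u y + \<eta> * R\<^sup>2" using etaR[OF yb] mult_nonneg_nonneg[OF less_imp_le[OF eps(1)] Bnn[of y]] by (simp add: w_def)
  hence "u y > M" using wy by simp
  hence yR: "y \<in> ball 0 R" using yb bd[of y] by (cases "norm y = R") auto
  \<comment> \<open>The maximum over \<open>C\<close> must avoid the boundaries of the removed balls
    in order to be a local maximum. Here \<open>y\<close> is not in \<open>S\<close>, so the
    convention \<open>1 / 0 = 0\<close> does not weaken the barrier.\<close>
  have far: "dist y s > \<rho>" if "s \<in> S" for s
  proof (rule ccontr)
    assume "\<not> dist y s > \<rho>"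
    moreover have "dist y s > 0" using CS[OF y(1)] that by auto
    ultimately have "1 / \<rho> \<le> 1 / dist y s" by (intro divide_left_mono) (use rho in auto)
    also have "\<dots> \<le> B y" unfolding B_def using S that by (intro member_le_sum) auto
    finally have "\<epsilon> * B y \<ge> \<epsilon> / \<rho>" using eps mult_left_mono[of "1/\<rho>" "B y" \<epsilon>] by simp
    moreover have "\<epsilon> / \<rho> > K - M" using rho K by (simp add: field_simps)
    ultimately have "w y < M + \<eta> * R\<^sup>2" using K(1)[OF yb] etaR[OF yb] by (simp add: w_def)
    thus False using wy by simp
  qed
  define T where "T = ball 0 R - (\<Union>s\<in>S. cball s \<rho>)"
  have T: "open T" "T \<subseteq> C" "y \<in> T"
    unfolding T_def C_def using S yR far by (force intro!: open_Diff simp: dist_commute)+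
  have yS: "y \<in> ball 0 R - S" using CS[OF y(1)] yR by simp
  have bl: "bounded_linear (\<lambda>x::real. c * x)" for c by (rule bounded_linear_mult_right)
  have Blim: "(second_difference_sum B y \<longlongrightarrow> (\<Sum>s\<in>S. 0)) (at_right 0)"
    unfolding B_def second_difference_sum_sum[OF S]
    using yS by (intro tendsto_sum second_difference_dist) auto
  \<comment> \<open>The 6 is twice the dimension. The second differences of \<open>w\<close> at its
    local maximum \<open>y\<close> thus tend to \<open>6 * \<eta> > 0\<close>, a
    contradiction.\<close>
  have "((\<lambda>t. (second_difference_sum u y t + (- \<epsilon>) * second_difference_sum B y t)
      + \<eta> * second_difference_sum (\<lambda>x. (norm x)\<^sup>2) y t) \<longlongrightarrow> (0 + (- \<epsilon>) * (\<Sum>s\<in>S. 0)) + \<eta> * 6) (at_right 0)"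
  proof (intro tendsto_intros harm[OF yS] Blim)
    have "\<forall>\<^sub>F t in at_right (0::real). second_difference_sum (\<lambda>x::real^3. (norm x)\<^sup>2) y t = 6"
      unfolding eventually_at_filter
      by (rule always_eventually) (auto simp: second_difference_sum_norm_sq)
    thus "(second_difference_sum (\<lambda>x::real^3. (norm x)\<^sup>2) y \<longlongrightarrow> 6) (at_right 0)"
      by (rule tendsto_eventually)
  qed
  moreover have "second_difference_sum w y = (\<lambda>t. (second_difference_sum u y t + (- \<epsilon>) * second_difference_sum B y t)
      + \<eta> * second_difference_sum (\<lambda>x. (norm x)\<^sup>2) y t)"
    unfolding w_def by (rule ext) (simp only: second_difference_sum_linear(1) second_difference_sum_linear(2)[OF bl])
  ultimately have "(second_difference_sum w y \<longlongrightarrow> \<eta> * 6) (at_right 0)" by simp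
  from second_difference_local_max[OF this T(1,3)] have "\<eta> * 6 \<le> 0" using y(2) T(2) by blast
  thus False using eta by simp
qed

text \<open>One tagged division serves all \<open>x\<close> in \<open>K\<close> at once, because
  \<open>u\<close> is uniformly continuous on the compact set of sums \<open>x + y\<close> with
  \<open>x\<close> in \<open>K\<close> and \<open>y\<close> in the box. As a function of
  \<open>x\<close>, the Riemann sum is a finite combination of translates of
  \<open>u\<close>.\<close>

lemma box_average_riemann_sum:
  fixes u :: "'a::euclidean_space \<Rightarrow> real"
  assumes u: "continuous_on UNIV u" and K: "compact K" and e: "e > 0"
  shows "\<exists>p :: ('a \<times> 'a set) set. finite p \<and>
    (\<forall>x\<in>K. \<bar>integral (cbox a b) (\<lambda>y. u (x + y)) - (\<Sum>(t,k)\<in>p. measure lborel k * u (x + t))\<bar> \<le> e)"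
proof -
  \<comment> \<open>The added 1 keeps the denominator positive when the box is degenerate.\<close>
  define e' where "e' = e / (measure lborel (cbox a b) + 1)"
  have e': "e' > 0" using e content_pos_le[of "cbox a b"] unfolding e'_def
    by (intro divide_pos_pos) linarith+
  define C where "C = {x + y | x y. x \<in> K \<and> y \<in> cbox a b}"
  have "compact C" unfolding C_def by (rule compact_sums[OF K compact_cbox])
  hence "uniformly_continuous_on C u"
    using u by (intro compact_uniformly_continuous) (auto intro: continuous_on_subset)
  then obtain d where d: "d > 0" "\<And>x y. x \<in> C \<Longrightarrow> y \<in> C \<Longrightarrow> dist y x < d \<Longrightarrow> dist (u y) (u x) < e'"
    using e' unfolding uniformly_continuous_on_def by metis
  have "gauge (\<lambda>x::'a. ball x d)" using d by (intro gauge_ball) 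
  then obtain p where p: "p tagged_division_of (cbox a b)" "(\<lambda>x. ball x d) fine p"
    by (rule fine_division_exists)
  have fin: "finite p" using p(1) by auto
  show ?thesis
  proof (intro exI[of _ p] conjI fin ballI)
    fix x assume x: "x \<in> K"
    have int: "(\<lambda>y. u (x + y)) integrable_on cbox c d" for c d
      by (intro integrable_continuous continuous_on_compose2[OF u] continuous_intros) auto
    have "integral (cbox a b) (\<lambda>y. u (x + y)) = (\<Sum>(t,k)\<in>p. integral k (\<lambda>y. u (x + y)))"
      by (rule integral_combine_tagged_division_topdown[OF int p(1)])
    hence "\<bar>integral (cbox a b) (\<lambda>y. u (x + y)) - (\<Sum>(t,k)\<in>p. measure lborel k * u (x + t))\<bar>
        = \<bar>\<Sum>(t,k)\<in>p. integral k (\<lambda>y. u (x + y)) - measure lborel k * u (x + t)\<bar>"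
      by (simp add: sum_subtractf[symmetric] case_prod_unfold)
    also have "\<dots> \<le> (\<Sum>(t,k)\<in>p. \<bar>integral k (\<lambda>y. u (x + y)) - measure lborel k * u (x + t)\<bar>)"
      unfolding case_prod_unfold by (rule sum_abs)
    also have "\<dots> \<le> (\<Sum>(t,k)\<in>p. e' * measure lborel k)"
    proof (intro sum_mono, clarify)
      fix t k assume tk: "(t,k) \<in> p"
      obtain c c' where k: "k = cbox c c'" using tagged_division_ofD(4)[OF p(1) tk] by blast
      have sub: "k \<subseteq> cbox a b" "t \<in> k" "k \<subseteq> ball t d"
        using tagged_division_ofD(2,3)[OF p(1) tk] p(2) tk by (auto simp: fine_def)
      have "((\<lambda>y. u (x + y) - u (x + t)) has_integral (integral k (\<lambda>y. u (x + y)) - measure lborel k * u (x + t))) (cbox c c')"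
        unfolding k using has_integral_diff[OF integrable_integral[OF int] has_integral_const[of "u (x + t)"]] by simp
      moreover have "0 \<le> e'" using e' by simp
      moreover have "norm (u (x + y) - u (x + t)) \<le> e'" if "y \<in> cbox c c'" for y
      proof -
        have "y \<in> cbox a b" "t \<in> cbox a b" "dist t y < d" using that sub k by auto
        hence "x + y \<in> C" "x + t \<in> C" "dist (x + y) (x + t) < d"
          using x unfolding C_def by (blast, blast, simp add: dist_commute)
        from d(2)[OF this(2,1,3)] show ?thesis by (simp add: dist_norm)
      qed
      ultimately have "norm (integral k (\<lambda>y. u (x + y)) - measure lborel k * u (x + t)) \<le> e' * measure lborel (cbox c c')"
        by (intro has_integral_bound)
      thus "\<bar>integral k (\<lambda>y. u (x + y)) - measure lborel k * u (x + t)\<bar> \<le> e' * measure lborel k"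
        by (simp add: k)
    qed
    also have "\<dots> = e' * (\<Sum>(t,k)\<in>p. measure lborel k)" by (simp add: sum_distrib_left case_prod_unfold)
    also have "\<dots> = e' * measure lborel (cbox a b)" using additive_content_tagged_division[OF p(1)] by simp
    also have "\<dots> \<le> e' * (measure lborel (cbox a b) + 1)" using e' by simp
    also have "\<dots> = e" using content_pos_le[of "cbox a b"]
      unfolding e'_def by (intro nonzero_eq_divide_eq[THEN iffD1]) linarith+
    finally show "\<bar>integral (cbox a b) (\<lambda>y. u (x + y)) - (\<Sum>(t,k)\<in>p. measure lborel k * u (x + t))\<bar> \<le> e" .
  qed
qed

lemma second_difference_sum_shift:
  "second_difference_sum (\<lambda>x. u (x + t)) x = second_difference_sum u (x + t)"
  by (rule ext) (simp add: second_difference_sum_def algebra_simps)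

text \<open>The maximum principle is applied to the Riemann sum \<open>V\<close>. Of the error
  \<open>e\<close>, one third is the size of the average on a large sphere, one third the
  approximation there, and one third the approximation at \<open>x\<close>.\<close>

lemma punctured_liouville_box:
  fixes u :: "real^3 \<Rightarrow> real"
  assumes cont: "continuous_on UNIV u" and S: "finite S"
    and harm: "\<And>x. x \<notin> S \<Longrightarrow> (second_difference_sum u x \<longlongrightarrow> 0) (at_right 0)"
    and lim: "((\<lambda>x. integral (cbox a b) (\<lambda>y. u (x + y))) \<longlongrightarrow> 0) at_infinity"
  shows "integral (cbox a b) (\<lambda>y. u (x + y)) \<le> 0"
proof (rule field_le_epsilon)
  fix e :: real assume "e > 0"
  hence e3: "e / 3 > 0" by simp
  from tendstoD[OF lim e3] obtain R0 where R0: "\<And>x. norm x \<ge> R0 \<Longrightarrow> \<bar>integral (cbox a b) (\<lambda>y. u (x + y))\<bar> < e / 3"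
    by (auto simp: eventually_at_infinity)
  \<comment> \<open>Large enough for the decay to hold on the sphere and for \<open>x\<close> to lie
    in the closed ball.\<close>
  define R where "R = max R0 (norm x)"
  obtain p :: "((real^3) \<times> (real^3) set) set" where p: "finite p" "\<forall>x\<in>cball 0 R.
      \<bar>integral (cbox a b) (\<lambda>y. u (x + y)) - (\<Sum>(t,k)\<in>p. measure lborel k * u (x + t))\<bar> \<le> e / 3"
    using box_average_riemann_sum[where u=u and K="cball 0 R" and a=a and b=b, OF cont compact_cball e3] by (elim exE conjE)
  define V where "V x = (\<Sum>q\<in>p. measure lborel (snd q) * u (x + fst q))" for x
  have V: "\<bar>integral (cbox a b) (\<lambda>y. u (x + y)) - V x\<bar> \<le> e / 3" if "x \<in> cball 0 R" for x
    using p(2)[rule_format, OF that] by (simp add: V_def case_prod_unfold)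
  have "V x \<le> 2 * e / 3"
  \<comment> \<open>A translate of \<open>u\<close> by \<open>fst q\<close> is exceptional on
    \<open>S\<close> shifted back by \<open>fst q\<close>; the union over the finite
    \<open>p\<close> stays finite.\<close>
  proof (rule maximum_principle_punctured[where S="\<Union>q\<in>p. (\<lambda>s. s - fst q) ` S" and R=R])
    show "continuous_on (cball 0 R) V" unfolding V_def
      by (intro continuous_intros continuous_on_compose2[OF cont]) auto
    show "finite (\<Union>q\<in>p. (\<lambda>s. s - fst q) ` S)" using p S by auto
    show "x \<in> cball 0 R" by (simp add: R_def)
    fix y assume "y \<in> sphere (0::real^3) R"
    hence "y \<in> cball 0 R" "norm y \<ge> R0" by (auto simp: R_def)
    with V[of y] R0[of y] show "V y \<le> 2 * e / 3" by (simp add: abs_if split: if_splits)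
  next
    fix y assume "y \<in> ball 0 R - (\<Union>q\<in>p. (\<lambda>s. s - fst q) ` S)"
    hence y: "y + fst q \<notin> S" if "q \<in> p" for q using that by force
    have "((\<lambda>t. \<Sum>q\<in>p. measure lborel (snd q) * second_difference_sum u (y + fst q) t) \<longlongrightarrow> (\<Sum>q\<in>p. measure lborel (snd q) * 0)) (at_right 0)"
      by (intro tendsto_sum tendsto_mult_left harm y)
    thus "(second_difference_sum V y \<longlongrightarrow> 0) (at_right 0)"
      unfolding V_def second_difference_sum_sum[OF p(1)]
      by (simp add: second_difference_sum_linear(2)[OF bounded_linear_mult_right] second_difference_sum_shift)
  qed
  with V[of x] show "integral (cbox a b) (\<lambda>y. u (x + y)) \<le> 0 + e"
    by (simp add: R_def abs_if split: if_splits)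
qed

text \<open>If \<open>u x\<close> were positive, continuity would make the integral over a small box
  with corner \<open>x\<close> positive, against \<open>punctured_liouville_box\<close>. Opposite
  bounds come from applying the lemma to the negated function.\<close>

lemma punctured_liouville:
  fixes u :: "real^3 \<Rightarrow> real"
  assumes cont: "continuous_on UNIV u" and S: "finite S"
    and harm: "\<And>x. x \<notin> S \<Longrightarrow> (second_difference_sum u x \<longlongrightarrow> 0) (at_right 0)"
    and lim: "\<And>a b. ((\<lambda>x. integral (cbox a b) (\<lambda>y. u (x + y))) \<longlongrightarrow> 0) at_infinity"
  shows "u x \<le> 0"
proof (rule ccontr)
  assume "\<not> u x \<le> 0"
  hence pos: "u x > 0" by simp
  have "open {y. u x / 2 < u y}"
    using cont by (intro open_Collect_less continuous_intros) auto
  moreover have "x \<in> {y. u x / 2 < u y}" using pos by simp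
  ultimately obtain e where e: "e > 0" "ball x e \<subseteq> {y. u x / 2 < u y}"
    by (rule openE)
  hence e2: "\<And>y. dist x y < e \<Longrightarrow> u x / 2 < u y" by (auto simp: subset_iff)
  \<comment> \<open>With three sides of length \<open>e / 4\<close>, the sum norm bounds every point
    of the box by \<open>3 * e / 4 < e\<close>.\<close>
  define b :: "real^3" where "b = (e / 4) *\<^sub>R One"
  have bi: "b \<bullet> i = e / 4" if "i \<in> Basis" for i
    using that by (simp add: b_def inner_sum_left_Basis)
  have nb: "norm y < e" if "y \<in> cbox 0 b" for y
  proof -
    have "norm y \<le> (\<Sum>i\<in>Basis. \<bar>y \<bullet> i\<bar>)" by (rule norm_le_l1)
    also have "\<dots> \<le> (\<Sum>i\<in>(Basis::(real^3) set). e / 4)"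
      using that bi by (intro sum_mono) (auto simp: mem_box)
    finally show ?thesis using e(1) by simp
  qed
  have "measure lborel (cbox 0 b) > 0" using e(1) by (subst content_pos_lt_eq) (simp add: bi)
  hence "0 < measure lborel (cbox 0 b) * (u x / 2)" using pos by simp
  also have "\<dots> = integral (cbox 0 b) (\<lambda>y. u x / 2)" by simp
  also have "\<dots> \<le> integral (cbox 0 b) (\<lambda>y. u (x + y))"
  proof (rule integral_le)
    show "(\<lambda>y. u (x + y)) integrable_on cbox 0 b"
      by (intro integrable_continuous continuous_on_compose2[OF cont] continuous_intros) auto
    show "u x / 2 \<le> u (x + y)" if "y \<in> cbox 0 b" for y
      using e2[of "x + y"] nb[OF that] by (simp add: dist_norm)
  qed (rule integrable_const)
  also have "\<dots> \<le> 0" by (rule punctured_liouville_box[OF cont S harm lim])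
  finally show False by simp
qed

text \<open>The pointwise bound
  \<open>norm (\<psi> y) \<le> d + (norm (\<psi> y))\<^sup>2 / d\<close> trades the integral of
  \<open>norm \<psi>\<close> for a small multiple of the volume plus the square mass of \<psi> over
  a far box. That mass is part of the tail of a convergent integral.\<close>

lemma box_average_tendsto_0:
  fixes u :: "'a::euclidean_space \<Rightarrow> real" and \<psi> :: "'a \<Rightarrow> complex"
  assumes L2: "integrable lebesgue (\<lambda>x. (norm (\<psi> x))\<^sup>2)"
    and cont: "continuous_on UNIV u"
    and bd: "\<forall>\<^sub>F x in at_infinity. \<bar>u x\<bar> \<le> norm (\<psi> x) + g x"
    and g: "(g \<longlongrightarrow> 0) at_infinity"
  shows "((\<lambda>x. integral (cbox a b) (\<lambda>y. u (x + y))) \<longlongrightarrow> 0) at_infinity"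
proof (rule tendstoI)
  fix e :: real assume e: "e > 0"
  define c where "c = measure lborel (cbox a b)"
  have c: "c \<ge> 0" by (simp add: c_def)
  \<comment> \<open>One \<open>d\<close> absorbs \<open>g\<close> near infinity and the other comes
    from splitting \<open>norm (\<psi> y)\<close>; together they cost less than
    \<open>3 * e / 4\<close>, leaving \<open>e / 4\<close> for the tail.\<close>
  define d where "d = e / (4 * (c + 1))"
  have d: "d > 0" "2 * d * c < e / 2 + e / 4"
  proof -
    show "d > 0" using e c by (simp add: d_def)
    have "2 * d * (c + 1) = e / 2" using c by (simp add: d_def field_simps)
    thus "2 * d * c < e / 2 + e / 4" using \<open>d > 0\<close> e by (simp add: algebra_simps)
  qed
  define F where "F x = (norm (\<psi> x))\<^sup>2" for x
  have F: "F integrable_on UNIV" unfolding F_def[abs_def] by (rule integrable_on_lebesgue[OF L2])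
  have Fb: "F integrable_on cbox p q" for p q
    by (rule integrable_on_subcbox[OF F]) simp
  have Fnn: "F x \<ge> 0" for x by (simp add: F_def)
  have "d * e / 4 > 0" using d e by simp
  moreover have "\<forall>e>0. \<exists>B>0. \<forall>p q. ball 0 B \<subseteq> cbox p q \<longrightarrow> norm (integral (cbox p q) F - integral UNIV F) < e"
    using integrable_integral[OF F] unfolding has_integral_alt'[of F _ UNIV] by simp
  ultimately obtain B where B: "\<And>p q. ball 0 B \<subseteq> cbox p q \<Longrightarrow> norm (integral (cbox p q) F - integral UNIV F) < d * e / 4"
    by blast
  obtain m where m: "ball (0::'a) B \<subseteq> cbox (- m) m" using bounded_subset_cbox_symmetric[OF bounded_ball] by blast
  have "\<forall>\<^sub>F x in at_infinity. \<bar>u x\<bar> \<le> norm (\<psi> x) + d \<and> x \<notin> cbox (-m) m"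
  proof -
    obtain r where "cbox (-m) m \<subseteq> ball 0 r" using bounded_subset_ballD[OF bounded_cbox] by blast
    hence "\<forall>\<^sub>F x in at_infinity. x \<notin> cbox (-m) m"
      unfolding eventually_at_infinity by (intro exI[of _ r]) (auto simp: subset_iff)
    moreover have "\<forall>\<^sub>F x in at_infinity. g x < d" using order_tendstoD(2)[OF g d(1)] .
    ultimately show ?thesis using bd by eventually_elim auto
  qed
  then obtain r where r: "\<And>x. norm x \<ge> r \<Longrightarrow> \<bar>u x\<bar> \<le> norm (\<psi> x) + d \<and> x \<notin> cbox (-m) m"
    by (auto simp: eventually_at_infinity)
  obtain N where N: "cbox a b \<subseteq> ball 0 N" using bounded_subset_ballD[OF bounded_cbox] by blast
  show "\<forall>\<^sub>F x in at_infinity. dist (integral (cbox a b) (\<lambda>y. u (x + y))) 0 < e"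
    unfolding eventually_at_infinity
  proof (intro exI[of _ "r + N"] allI impI)
    fix x :: 'a assume x: "norm x \<ge> r + N"
    define Q where "Q = cbox (a + x) (b + x)"
    have Qr: "norm y \<ge> r" if "y \<in> Q" for y
    proof -
      have "y - x \<in> cbox a b" using that by (auto simp: Q_def mem_box inner_simps algebra_simps)
      hence "norm (y - x) < N" using N by (auto simp: subset_iff)
      thus ?thesis using x norm_triangle_ineq2[of x "x - y"] by (simp add: norm_minus_commute)
    qed
    \<comment> \<open>The far box \<open>Q\<close> is disjoint from a box that already carries all
      but \<open>d * e / 4\<close> of the total mass.\<close>
    have "integral (cbox (-m) m) F + integral Q F = integral (cbox (-m) m \<union> Q) F"
    proof (rule integral_Un[symmetric])
      have "cbox (-m) m \<inter> Q = {}" using Qr r by blast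
      thus "negligible (cbox (-m) m \<inter> Q)" by simp
    qed (auto simp: Q_def Fb)
    also have "\<dots> \<le> integral UNIV F"
    proof (rule integral_subset_le)
      have "cbox (-m) m \<inter> Q = {}" using Qr r by blast
      thus "F integrable_on cbox (-m) m \<union> Q" by (intro integrable_Un) (auto simp: Q_def Fb)
    qed (auto simp: F Fnn)
    finally have FQ: "integral Q F < d * e / 4" using B[OF m] by (simp add: abs_if split: if_splits)
    have "integral (cbox a b) (\<lambda>y. u (x + y)) = integral Q u"
      using integral_shift_cbox_plus[of a b u x] by (simp add: Q_def o_def)
    also have "norm \<dots> \<le> integral Q (\<lambda>y. 2 * d + F y / d)"
      unfolding Q_def
    proof (rule integral_norm_bound_integral)
      show "u integrable_on cbox (a + x) (b + x)"
        by (intro integrable_continuous continuous_on_subset[OF cont]) simp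
      show "(\<lambda>y. 2 * d + F y / d) integrable_on cbox (a + x) (b + x)"
        by (intro integrable_add integrable_const integrable_on_divide Fb)
      fix y assume "y \<in> cbox (a + x) (b + x)"
      hence "\<bar>u y\<bar> \<le> norm (\<psi> y) + d" using r Qr by (simp add: Q_def)
      also have "norm (\<psi> y) \<le> d + F y / d"
      proof (cases "norm (\<psi> y) \<le> d")
        case True thus ?thesis using Fnn[of y] d by (simp add: add_increasing2)
      next
        case False
        hence "d * norm (\<psi> y) \<le> F y" using d by (simp add: F_def power2_eq_square mult_right_mono)
        hence "norm (\<psi> y) \<le> F y / d" using d by (simp add: field_simps)
        thus ?thesis using d by simp
      qed
      finally show "norm (u y) \<le> 2 * d + F y / d" by simp
    qed
    also have "\<dots> = 2 * d * measure lborel Q + integral Q F / d"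
      unfolding Q_def by (subst integral_add) (auto intro!: integrable_on_divide Fb simp: mult.commute)
    also have "measure lborel Q = c"
      unfolding Q_def c_def by (auto simp: content_cbox_if box_eq_empty inner_simps)
    also have "integral Q F / d < e / 4" using FQ d by (simp add: field_simps)
    finally show "dist (integral (cbox a b) (\<lambda>y. u (x + y))) 0 < e" using d(2) by simp
  qed
qed

section \<open>Finite exceptional sets and removable singularities\<close>

lemma eventually_at_notin_finite:
  fixes Z :: "'a::t1_space set"
  assumes "finite Z"
  shows "\<forall>\<^sub>F x in at a. x \<notin> Z"
proof -
  have "open (- (Z - {a}))" using assms by (intro open_Compl finite_imp_closed) simp
  hence "\<forall>\<^sub>F x in at a. x \<in> - (Z - {a})" by (auto simp: eventually_at_topological)
  thus ?thesis unfolding eventually_at_filter by eventually_elim auto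
qed

lemma eventually_notin_finite_at_infinity:
  assumes "finite (Z :: 'a::real_normed_vector set)"
  shows "\<forall>\<^sub>F x in at_infinity. x \<notin> Z"
proof -
  obtain B where "\<And>x. x \<in> Z \<Longrightarrow> norm x \<le> B"
    using finite_imp_bounded[OF assms] by (auto simp: bounded_iff)
  thus ?thesis unfolding eventually_at_infinity by (intro exI[of _ "B + 1"]) force
qed

text \<open>Extends continuity across \<open>Z\<close>; this is the regularity at exceptional points
  that \<open>punctured_liouville\<close> asks for.\<close>

lemma removable_singularities:
  fixes h :: "'a::t2_space \<Rightarrow> 'b::t2_space"
  assumes "finite Z" "continuous_on (- Z) h" "\<And>a. a \<in> Z \<Longrightarrow> \<exists>l. (h \<longlongrightarrow> l) (at a)"
  obtains H where "continuous_on UNIV H" "\<And>x. x \<notin> Z \<Longrightarrow> H x = h x"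
proof -
  obtain l where l: "\<And>a. a \<in> Z \<Longrightarrow> (h \<longlongrightarrow> l a) (at a)" using assms(3) by metis
  define H where "H x = (if x \<in> Z then l x else h x)" for x
  have o: "open (- Z)" using assms(1) by (intro open_Compl finite_imp_closed)
  have "isCont H x" for x
  proof -
    have ev: "\<forall>\<^sub>F y in at x. h y = H y"
      using eventually_at_notin_finite[OF assms(1)] by eventually_elim (simp add: H_def)
    have "(h \<longlongrightarrow> H x) (at x)"
      using l[of x] assms(2) o by (auto simp: H_def continuous_on_eq_continuous_at isCont_def)
    thus ?thesis unfolding isCont_def using tendsto_cong[OF ev] by blast
  qed
  hence "continuous_on UNIV H" by (simp add: continuous_at_imp_continuous_on)
  thus ?thesis by (rule that) (simp add: H_def)
qed

subsection \<open>Coulomb potentials of finitely many charges\<close>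

text \<open>The factor \<open>- 1 / (4 * pi)\<close> of \<open>psi_of\<close> is absorbed into the
  charges, so that \<open>c j\<close> is directly the coefficient of the pole at
  \<open>z j\<close>.\<close>

definition coulomb :: "nat \<Rightarrow> (nat \<Rightarrow> real^3) \<Rightarrow> (nat \<Rightarrow> complex) \<Rightarrow> real^3 \<Rightarrow> complex" where
  "coulomb n z c x = (\<Sum>j<n. c j / of_real (dist x (z j)))"

lemma psi_of_eq_coulomb: "psi_of n z q = coulomb n z (\<lambda>j. - q j / (4 * of_real pi))"
  unfolding psi_of_def coulomb_def sum_distrib_left by (intro ext sum.cong refl) simp

lemma harmonic_on_subset: "harmonic_on S f \<Longrightarrow> T \<subseteq> S \<Longrightarrow> harmonic_on T f"
  by (auto simp: harmonic_on_def)

lemma harmonic_on_coulomb_sum: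
  assumes "finite A"
  shows "harmonic_on (- (z ` A)) (\<lambda>x. \<Sum>j\<in>A. c j / of_real (dist x (z j)))"
proof -
  have "harmonic_on (- (z ` A)) (\<lambda>x. \<Sum>j\<in>A. c j * (1 / of_real (dist x (z j))))"
    using assms
    by (intro harmonic_on_sum open_Compl finite_imp_closed finite_imageI
          harmonic_on_subset[OF harmonic_on_inverse_dist]) auto
  thus ?thesis by simp
qed

lemma harmonic_on_continuous: "harmonic_on S f \<Longrightarrow> continuous_on S f"
  by (auto simp: harmonic_on_def intro!: continuous_at_imp_continuous_on differentiable_imp_continuous_within)

text \<open>The local expansion of a bound state with the relation between \<open>a\<close> and
  \<open>b\<close> left out, so that it applies to arbitrary Coulomb potentials too.\<close>

definition point_expansion :: "(real^3 \<Rightarrow> complex) \<Rightarrow> real^3 \<Rightarrow> complex \<Rightarrow> complex \<Rightarrow> bool" where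
  "point_expansion f p a b \<longleftrightarrow> (\<exists>C \<delta>::real. \<delta> > 0 \<and>
     (\<forall>x. 0 < dist x p \<and> dist x p < \<delta> \<longrightarrow> norm (f x - a / of_real (dist x p) - b) \<le> C * dist x p))"

lemma point_expansion_tendsto:
  assumes "point_expansion f p a b"
  shows "((\<lambda>x. f x - a / of_real (dist x p)) \<longlongrightarrow> b) (at p)"
proof -
  obtain C \<delta> where *: "\<delta> > 0" "\<And>x. 0 < dist x p \<Longrightarrow> dist x p < \<delta> \<Longrightarrow> norm (f x - a / of_real (dist x p) - b) \<le> C * dist x p"
    using assms unfolding point_expansion_def by blast
  have "((\<lambda>x. f x - a / of_real (dist x p) - b) \<longlongrightarrow> 0) (at p)"
  proof (rule Lim_null_comparison)
    show "\<forall>\<^sub>F x in at p. norm (f x - a / of_real (dist x p) - b) \<le> C * dist x p"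
      unfolding eventually_at using * by auto
    show "((\<lambda>x. C * dist x p) \<longlongrightarrow> 0) (at p)" by (auto intro!: tendsto_eq_intros)
  qed
  thus ?thesis by (simp add: LIM_zero_iff)
qed

text \<open>Multiplying the difference of the regular parts by \<open>dist x p\<close> leaves the
  constant \<open>a' - a\<close>, which must tend to 0. Once the poles agree, \<open>b = b'\<close>
  is uniqueness of limits.\<close>

lemma point_expansion_unique:
  assumes "point_expansion f p a b" "point_expansion g p a' b'" "\<forall>\<^sub>F x in at p. f x = g x"
  shows "a = a'" "b = b'"
proof -
  have f: "((\<lambda>x. f x - a / of_real (dist x p)) \<longlongrightarrow> b) (at p)"
    and g: "((\<lambda>x. g x - a' / of_real (dist x p)) \<longlongrightarrow> b') (at p)"
    using assms point_expansion_tendsto by blast+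
  have "((\<lambda>x. of_real (dist x p) * ((f x - a / of_real (dist x p)) - (g x - a' / of_real (dist x p))))
     \<longlongrightarrow> of_real 0 * (b - b')) (at p)"
    by (intro tendsto_intros f g) (auto intro!: tendsto_eq_intros)
  moreover have "\<forall>\<^sub>F x in at p. of_real (dist x p) * ((f x - a / of_real (dist x p)) - (g x - a' / of_real (dist x p))) = a' - a"
    using assms(3) unfolding eventually_at_filter
    by eventually_elim (auto simp: field_simps)
  ultimately have "((\<lambda>x. a' - a) \<longlongrightarrow> 0) (at p)" by (simp add: tendsto_cong)
  thus "a = a'" by (simp add: tendsto_const_iff)
  have "\<forall>\<^sub>F x in at p. f x - a / of_real (dist x p) = g x - a' / of_real (dist x p)"
    using assms(3) by eventually_elim (simp add: \<open>a = a'\<close>)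
  from tendsto_cong[OF this] f have "((\<lambda>x. g x - a' / of_real (dist x p)) \<longlongrightarrow> b) (at p)" by simp
  from tendsto_unique[OF trivial_limit_at this g] show "b = b'" .
qed

text \<open>Injectivity keeps the other charges away from \<open>z j\<close>, so their potential
  \<open>r\<close> is differentiable there: its value is the constant term, and its derivative gives
  the linear remainder.\<close>

lemma coulomb_expansion:
  assumes inj: "inj_on z {..<n}" and j: "j < n"
  shows "point_expansion (coulomb n z c) (z j) (c j)
           (\<Sum>k\<in>{..<n} - {j}. c k / of_real (dist (z j) (z k)))"
proof -
  define r where "r x = (\<Sum>k\<in>{..<n} - {j}. c k / complex_of_real (dist x (z k)))" for x
  have "z j \<in> - (z ` ({..<n} - {j}))" using inj j by (auto simp: inj_on_def)
  hence "r differentiable at (z j)"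
    using harmonic_on_coulomb_sum[of "{..<n} - {j}" z c] unfolding r_def[abs_def]
    by (auto simp: harmonic_on_def)
  then obtain r' where r': "(r has_derivative r') (at (z j))" by (auto simp: differentiable_def)
  obtain d where d: "d > 0" "\<And>y. norm (y - z j) < d \<Longrightarrow> norm (r y - r (z j) - r' (y - z j)) \<le> 1 * norm (y - z j)"
    using r' unfolding has_derivative_at_alt by (meson zero_less_one)
  have bl: "bounded_linear r'" using r' by (rule has_derivative_bounded_linear)
  show ?thesis unfolding point_expansion_def
  proof (intro exI[of _ "1 + onorm r'"] exI[of _ d] conjI allI impI d(1), elim conjE)
    fix x assume x: "0 < dist x (z j)" "dist x (z j) < d"
    have "coulomb n z c x = c j / of_real (dist x (z j)) + r x"
      unfolding coulomb_def r_def using j by (subst sum.remove[of _ j]) auto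
    hence "norm (coulomb n z c x - c j / of_real (dist x (z j)) - r (z j)) = norm ((r x - r (z j) - r' (x - z j)) + r' (x - z j))"
      by simp
    also have "\<dots> \<le> norm (x - z j) + onorm r' * norm (x - z j)"
      using d(2)[of x] x onorm[OF bl, of "x - z j"] by (intro norm_triangle_le add_mono) (auto simp: dist_norm)
    finally show "norm (coulomb n z c x - c j / of_real (dist x (z j)) -
        (\<Sum>k\<in>{..<n} - {j}. c k / of_real (dist (z j) (z k)))) \<le> (1 + onorm r') * dist x (z j)"
      by (simp add: r_def dist_norm algebra_simps)
  qed
qed

section \<open>Coulomb potentials near infinity\<close>

lemma inverse_dist_at_infinity:
  "((\<lambda>x::'a::real_normed_vector. 1 / dist x a) \<longlongrightarrow> 0) at_infinity"
proof -
  have "filterlim (\<lambda>x. dist x a) at_top at_infinity"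
  proof (rule filterlim_at_top_mono)
    show "filterlim (\<lambda>x. - norm a + norm x) at_top at_infinity"
      by (rule filterlim_tendsto_add_at_top[OF tendsto_const filterlim_norm_at_top])
    show "\<forall>\<^sub>F x in at_infinity. - norm a + norm x \<le> dist x a"
      using norm_triangle_ineq2[of _ a] by (intro always_eventually) (simp add: dist_norm algebra_simps)
  qed
  from tendsto_inverse_0_at_top[OF this] show ?thesis by (simp add: divide_inverse)
qed

lemma norm_div_dist_at_infinity:
  "((\<lambda>x::'a::real_normed_vector. norm x / dist x a) \<longlongrightarrow> 1) at_infinity"
proof -
  have "((\<lambda>x. norm x / dist x a - 1) \<longlongrightarrow> 0) at_infinity"
  proof (rule Lim_null_comparison)
    show "((\<lambda>x::'a. norm a * (1 / dist x a)) \<longlongrightarrow> 0) at_infinity"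
      using tendsto_mult_left[OF inverse_dist_at_infinity, of "norm a"] by simp
    have "norm (norm x / dist x a - 1) \<le> norm a * (1 / dist x a)" if "x \<noteq> a" for x
    proof -
      have "norm (norm x / dist x a - 1) = \<bar>norm x - dist x a\<bar> / dist x a"
        using that by (simp add: abs_if field_simps)
      also have "\<dots> \<le> norm a / dist x a"
        using norm_triangle_ineq3[of x "x - a"] by (intro divide_right_mono) (auto simp: dist_norm)
      finally show ?thesis by simp
    qed
    moreover have "\<forall>\<^sub>F x in at_infinity. x \<noteq> a"
      unfolding eventually_at_infinity by (intro exI[of _ "norm a + 1"]) auto
    ultimately show "\<forall>\<^sub>F x in at_infinity. norm (norm x / dist x a - 1) \<le> norm a * (1 / dist x a)"
      by (auto elim: eventually_mono)
  qed
  thus ?thesis by (simp add: LIM_zero_iff)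
qed

lemma coulomb_at_infinity:
  "((\<lambda>x. of_real (norm x) * coulomb n z c x) \<longlongrightarrow> (\<Sum>j<n. c j)) at_infinity"
proof -
  have "((\<lambda>x. \<Sum>j<n. c j * of_real (norm x / dist x (z j))) \<longlongrightarrow> (\<Sum>j<n. c j * of_real 1)) at_infinity"
    by (intro tendsto_intros tendsto_of_real norm_div_dist_at_infinity)
  thus ?thesis by (simp add: coulomb_def sum_distrib_left mult.commute)
qed

lemma coulomb_tendsto_0: "(coulomb n z c \<longlongrightarrow> 0) at_infinity"
proof -
  have "((\<lambda>x. \<Sum>j<n. c j * of_real (1 / dist x (z j))) \<longlongrightarrow> (\<Sum>j<n. c j * of_real 0)) at_infinity"
    by (intro tendsto_intros tendsto_of_real inverse_dist_at_infinity)
  thus ?thesis by (simp add: coulomb_def[abs_def])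
qed

text \<open>For total charge \<open>s\<close> different from 0, \<open>norm (\<psi> x)\<close> is at
  least \<open>norm s / (2 * norm x)\<close> far out. On a cube of side \<open>R\<close> at distance
  of order \<open>R\<close> this gives square mass at least
  \<open>R * (norm s)\<^sup>2 / 144\<close>, which is unbounded in \<open>R\<close>.\<close>

lemma square_integrable_coulomb_sum_0:
  assumes L2: "integrable lebesgue (\<lambda>x. (norm (\<psi> x))\<^sup>2)"
    and eq: "\<forall>\<^sub>F x in at_infinity. \<psi> x = coulomb n z c x"
  shows "(\<Sum>j<n. c j) = 0"
proof (rule ccontr)
  define s where "s = (\<Sum>j<n. c j)"
  assume "(\<Sum>j<n. c j) \<noteq> 0"
  hence s: "norm s > 0" by (simp add: s_def)
  define F where "F x = (norm (\<psi> x))\<^sup>2" for x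
  have F: "F integrable_on UNIV" unfolding F_def[abs_def] by (rule integrable_on_lebesgue[OF L2])
  have Fb: "F integrable_on cbox p q" for p q
    by (rule integrable_on_subcbox[OF F]) simp
  have "((\<lambda>x. norm (of_real (norm x) * coulomb n z c x)) \<longlongrightarrow> norm s) at_infinity"
    unfolding s_def by (intro tendsto_norm coulomb_at_infinity)
  hence "\<forall>\<^sub>F x in at_infinity. norm s / 2 < norm (of_real (norm x) * coulomb n z c x)"
    by (rule order_tendstoD) (use s in simp)
  hence "\<forall>\<^sub>F x in at_infinity. norm s / 2 < norm x * norm (\<psi> x)"
    using eq by eventually_elim (simp add: norm_mult)
  then obtain R0 where R0: "\<And>x. norm x \<ge> R0 \<Longrightarrow> norm s / 2 < norm x * norm (\<psi> x)"
    by (auto simp: eventually_at_infinity)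
  \<comment> \<open>Points of the cube have norm at most \<open>6 * R\<close>, and
    \<open>144 = (2 * 6)\<^sup>2\<close>. The 1 added to the integral makes the final contradiction
    strict.\<close>
  define R where "R = max (max R0 1) (144 * (integral UNIV F + 1) / (norm s)\<^sup>2)"
  have R: "R \<ge> R0" "R \<ge> 1" "R * (norm s)\<^sup>2 \<ge> 144 * (integral UNIV F + 1)"
  proof -
    have "144 * (integral UNIV F + 1) / (norm s)\<^sup>2 \<le> R" by (simp add: R_def)
    thus "R * (norm s)\<^sup>2 \<ge> 144 * (integral UNIV F + 1)" using s by (subst (asm) pos_divide_le_eq) simp_all
  qed (simp_all add: R_def)
  define Q where "Q = cbox (R *\<^sub>R One :: real^3) ((2 * R) *\<^sub>R One)"
  have Q: "norm x \<ge> R" "norm x \<le> 6 * R" if "x \<in> Q" for x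
  proof -
    have i: "R \<le> x \<bullet> i" "x \<bullet> i \<le> 2 * R" if "i \<in> Basis" for i
      using \<open>x \<in> Q\<close> that by (auto simp: Q_def mem_box inner_sum_left_Basis)
    obtain i :: "real^3" where ib: "i \<in> Basis" using nonempty_Basis by blast
    show "norm x \<ge> R" using i[OF ib] Basis_le_norm[OF ib, of x] by simp
    have "norm x \<le> (\<Sum>i\<in>Basis. \<bar>x \<bullet> i\<bar>)" by (rule norm_le_l1)
    also have "\<dots> \<le> (\<Sum>i\<in>(Basis::(real^3) set). 2 * R)"
      using i R by (intro sum_mono) force
    finally show "norm x \<le> 6 * R" by simp
  qed
  have "measure lborel Q = (\<Prod>i\<in>(Basis::(real^3) set). R)"
    unfolding Q_def using R by (subst content_cbox) (auto simp: inner_sum_left_Basis)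
  hence mQ: "measure lborel Q = R ^ 3" by simp
  have "(norm s)\<^sup>2 / (144 * R\<^sup>2) * R ^ 3 = integral Q (\<lambda>x. (norm s)\<^sup>2 / (144 * R\<^sup>2))"
    using mQ unfolding Q_def by simp
  also have "\<dots> \<le> integral Q F"
    unfolding Q_def
  proof (rule integral_le[OF integrable_const Fb])
    fix x assume "x \<in> cbox (R *\<^sub>R One :: real^3) ((2 * R) *\<^sub>R One)"
    hence x: "norm x \<ge> R" "norm x \<le> 6 * R" using Q by (auto simp: Q_def)
    have "norm s / 2 \<le> norm x * norm (\<psi> x)" using R0[of x] x R by simp
    also have "\<dots> \<le> 6 * R * norm (\<psi> x)" using x by (intro mult_right_mono) auto
    finally have "norm s / (12 * R) \<le> norm (\<psi> x)" using R by (simp add: field_simps)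
    hence "(norm s / (12 * R))\<^sup>2 \<le> F x" unfolding F_def using R by (intro power_mono) auto
    thus "(norm s)\<^sup>2 / (144 * R\<^sup>2) \<le> F x" by (simp add: power_divide power_mult_distrib)
  qed
  also have "\<dots> \<le> integral UNIV F"
    unfolding Q_def by (intro integral_subset_le Fb F) (auto simp: F_def)
  also have "(norm s)\<^sup>2 / (144 * R\<^sup>2) * R ^ 3 = R * (norm s)\<^sup>2 / 144"
    using R by (simp add: field_simps power_numeral_reduce)
  finally show False using R(3) by simp
qed

lemma coulomb_eq_imp_coeffs_eq:
  assumes "inj_on z {..<n}" "\<And>x. x \<notin> z ` {..<n} \<Longrightarrow> coulomb n z c x = coulomb n z c' x" "j < n"
  shows "c j = c' j"
proof (rule point_expansion_unique(1)[OF coulomb_expansion coulomb_expansion])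
  show "\<forall>\<^sub>F x in at (z j). coulomb n z c x = coulomb n z c' x"
    by (rule eventually_mono[OF eventually_at_notin_finite[of "z ` {..<n}"] assms(2)]) auto
qed (use assms in auto)

section \<open>Square integrability of potentials of total charge zero\<close>

lemma summand_le_suminf:
  fixes f :: "nat \<Rightarrow> ennreal"
  shows "f l \<le> (\<Sum>k. f k)"
  using sum_le_suminf[of f "{l}"] by simp

text \<open>In dimension three the power 2 is integrable near \<open>a\<close> and the power 4 near
  infinity. The function is dominated by weighted indicators of dyadic balls; the integrals form
  geometric series of ratio \<open>4 / 8\<close> for \<open>g1\<close> and \<open>8 / 16\<close> for
  \<open>g2\<close>.\<close>

lemma integrable_inverse_powers_dist:
  fixes a :: "real^3"
  shows "integrable lborel (\<lambda>x. min (1 / dist x a ^ 2) (1 / dist x a ^ 4))"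
proof -
  define f where "f x = min (1 / dist x a ^ 2) (1 / dist x a ^ 4)" for x
  have f0: "f x \<ge> 0" for x by (simp add: f_def)
  define V where "V = unit_ball_vol 3"
  have V: "V \<ge> 0" by (simp add: V_def)
  have ball: "emeasure lborel (ball a r) = ennreal (V * r ^ 3)" if "r \<ge> 0" for r
    using emeasure_ball[OF that, of a] by (simp add: V_def)
  have fm: "f \<in> borel_measurable lborel" unfolding f_def by measurable
  have [measurable]: "ball a r \<in> sets borel" for r by simp
  define g1 where "g1 x = (\<Sum>k. ennreal (4 * 4 ^ k) * indicator (ball a ((1/2) ^ k)) x)" for x
  define g2 where "g2 x = (\<Sum>k. ennreal ((1/16) ^ k) * indicator (ball a (2 * 2 ^ k)) x)" for x
  have le: "ennreal (f x) \<le> g1 x + g2 x" for x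
  proof (cases "x = a")
    case True thus ?thesis by (simp add: f_def)
  next
    case False
    hence r: "dist x a > 0" by simp
    show ?thesis
    proof (cases "dist x a < 1")
      case True
      obtain m where m: "(1/2) ^ m < dist x a" using real_arch_pow_inv[OF r, of "1/2"] by auto
      \<comment> \<open>The predecessor \<open>l\<close> of this index names the annulus of
        \<open>x\<close>: \<open>dist x a\<close> lies between \<open>(1/2) ^ Suc l\<close> and
        \<open>(1/2) ^ l\<close>. This explains the extra factor 4 in \<open>g1\<close>.\<close>
      define k where "k = (LEAST m. (1/2) ^ m \<le> dist x a)"
      have k: "(1/2) ^ k \<le> dist x a" unfolding k_def by (rule LeastI[of _ m]) (use m in simp)
      hence "k \<noteq> 0" using True by (intro notI) simp
      then obtain l where l: "k = Suc l" by (cases k) auto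
      have "\<not> (1/2) ^ l \<le> dist x a" using not_less_Least[of l "\<lambda>m. (1/2) ^ m \<le> dist x a"] l by (simp add: k_def)
      hence xl: "x \<in> ball a ((1/2) ^ l)" by (simp add: dist_commute)
      have "((1/2) ^ Suc l)\<^sup>2 \<le> dist x a ^ 2" using k l by (intro power_mono) auto
      hence "1 / dist x a ^ 2 \<le> 1 / ((1/2) ^ Suc l)\<^sup>2" using r by (intro divide_left_mono) auto
      also have "\<dots> = 4 * 4 ^ l" by (simp add: power_divide power_mult_distrib power2_eq_square power_mult[symmetric] flip: power_mult_distrib)
      finally have "f x \<le> 4 * 4 ^ l" by (simp add: f_def)
      hence "ennreal (f x) \<le> ennreal (4 * 4 ^ l) * indicator (ball a ((1/2) ^ l)) x"
        using xl by (simp add: ennreal_leI)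
      also have "\<dots> \<le> g1 x" unfolding g1_def by (rule summand_le_suminf)
      finally show ?thesis by (simp add: add_increasing2)
    next
      case False
      obtain m where m: "dist x a < 2 ^ m" using real_arch_pow[of 2 "dist x a"] by auto
      \<comment> \<open>Here \<open>dist x a\<close> lies between \<open>2 ^ l\<close> and
        \<open>2 ^ Suc l\<close>, which is why the balls in \<open>g2\<close> have radius
        \<open>2 * 2 ^ k\<close>.\<close>
      define k where "k = (LEAST m. dist x a < 2 ^ m)"
      have k: "dist x a < 2 ^ k" unfolding k_def by (rule LeastI[of _ m]) (use m in simp)
      hence "k \<noteq> 0" using False by (intro notI) simp
      then obtain l where l: "k = Suc l" by (cases k) auto
      have "\<not> dist x a < 2 ^ l" using not_less_Least[of l "\<lambda>m. dist x a < 2 ^ m"] l by (simp add: k_def)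
      hence "(2 ^ l) ^ 4 \<le> dist x a ^ 4" by (intro power_mono) auto
      hence "1 / dist x a ^ 4 \<le> 1 / (2 ^ l) ^ 4" using r by (intro divide_left_mono) auto
      also have "(2 ^ l) ^ 4 = ((2::real) ^ 4) ^ l" by (simp only: power_mult[symmetric] mult.commute)
      finally have "f x \<le> (1/16) ^ l" by (simp add: f_def power_divide)
      moreover have "x \<in> ball a (2 * 2 ^ l)" using k l by (simp add: dist_commute)
      ultimately have "ennreal (f x) \<le> ennreal ((1/16) ^ l) * indicator (ball a (2 * 2 ^ l)) x"
        by (simp add: ennreal_leI)
      also have "\<dots> \<le> g2 x" unfolding g2_def by (rule summand_le_suminf)
      finally show ?thesis by (simp add: add_increasing)
    qed
  qed
  have sm: "summable (\<lambda>k. C * (1/2) ^ k :: real)" for C by (intro summable_mult summable_geometric) auto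
  have "(\<integral>\<^sup>+x. g1 x \<partial>lborel) = (\<Sum>k. \<integral>\<^sup>+x. ennreal (4 * 4 ^ k) * indicator (ball a ((1/2) ^ k)) x \<partial>lborel)"
    unfolding g1_def by (rule nn_integral_suminf) measurable
  also have "\<dots> = (\<Sum>k. ennreal (4 * V * (1/2) ^ k))"
  proof (intro suminf_cong)
    fix k :: nat
    have "((1/2) ^ k) ^ 3 = ((1/2::real) ^ 3) ^ k" by (simp only: power_mult[symmetric] mult.commute)
    moreover have "4 ^ k * (1/8) ^ k = (1/2::real) ^ k" by (simp flip: power_mult_distrib)
    ultimately have "4 * 4 ^ k * (V * ((1/2) ^ k) ^ 3) = 4 * V * (1/2) ^ k"
      by (simp add: power3_eq_cube)
    thus "(\<integral>\<^sup>+x. ennreal (4 * 4 ^ k) * indicator (ball a ((1/2) ^ k)) x \<partial>lborel) = ennreal (4 * V * (1/2) ^ k)"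
      using V by (simp add: nn_integral_cmult_indicator ball flip: ennreal_mult')
  qed
  also have "\<dots> \<noteq> top" using V by (intro ennreal_suminf_neq_top sm) auto
  finally have i1: "(\<integral>\<^sup>+x. g1 x \<partial>lborel) \<noteq> top" .
  have "(\<integral>\<^sup>+x. g2 x \<partial>lborel) = (\<Sum>k. \<integral>\<^sup>+x. ennreal ((1/16) ^ k) * indicator (ball a (2 * 2 ^ k)) x \<partial>lborel)"
    unfolding g2_def by (rule nn_integral_suminf) measurable
  also have "\<dots> = (\<Sum>k. ennreal (8 * V * (1/2) ^ k))"
  proof (intro suminf_cong)
    fix k :: nat
    have "(2 * 2 ^ k) ^ 3 = 8 * ((2::real) ^ 3) ^ k"
      by (simp only: power_mult_distrib power_mult[symmetric] mult.commute) simp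
    moreover have "(1/16) ^ k * 8 ^ k = (1/2::real) ^ k" by (simp flip: power_mult_distrib)
    ultimately have "(1/16) ^ k * (V * (2 * 2 ^ k) ^ 3) = 8 * V * (1/2) ^ k"
      by simp
    thus "(\<integral>\<^sup>+x. ennreal ((1/16) ^ k) * indicator (ball a (2 * 2 ^ k)) x \<partial>lborel) = ennreal (8 * V * (1/2) ^ k)"
      using V by (simp add: nn_integral_cmult_indicator ball flip: ennreal_mult')
  qed
  also have "\<dots> \<noteq> top" using V by (intro ennreal_suminf_neq_top sm) auto
  finally have i2: "(\<integral>\<^sup>+x. g2 x \<partial>lborel) \<noteq> top" .
  have "(\<integral>\<^sup>+x. f x \<partial>lborel) \<le> (\<integral>\<^sup>+x. g1 x + g2 x \<partial>lborel)" by (intro nn_integral_mono le)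
  also have "\<dots> = (\<integral>\<^sup>+x. g1 x \<partial>lborel) + (\<integral>\<^sup>+x. g2 x \<partial>lborel)"
    unfolding g1_def g2_def by (rule nn_integral_add) measurable
  also have "\<dots> < \<infinity>" using i1 i2 by (simp add: less_top)
  finally have "integrable lborel f"
    using fm f0 by (intro integrableI_bounded) simp_all
  thus ?thesis unfolding f_def[abs_def] .
qed

text \<open>With \<open>r\<close> the smaller distance, the difference of inverses is at most
  \<open>1 / r\<close> and also at most \<open>d / r\<^sup>2\<close>. The factor
  \<open>1 + d\<^sup>2\<close> covers the squares of both bounds.\<close>

lemma inverse_diff_sq_le:
  fixes p q d :: real
  assumes "p > 0" "q > 0" "\<bar>p - q\<bar> \<le> d"
  shows "(1 / p - 1 / q)\<^sup>2 \<le> (1 + d\<^sup>2) * (min (1 / p ^ 2) (1 / p ^ 4) + min (1 / q ^ 2) (1 / q ^ 4))"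
proof -
  have main: "(1 / r - 1 / s)\<^sup>2 \<le> (1 + d\<^sup>2) * min (1 / r ^ 2) (1 / r ^ 4)"
    if "0 < r" "r \<le> s" "\<bar>r - s\<bar> \<le> d" for r s
  proof -
    have "1 / s \<le> 1 / r" using that by (intro divide_left_mono) auto
    hence "(1 / r - 1 / s)\<^sup>2 \<le> (1 / r)\<^sup>2" using that by (intro power_mono) auto
    also have "\<dots> \<le> (1 + d\<^sup>2) * (1 / r ^ 2)" using that by (simp add: power_divide divide_right_mono)
    finally have 1: "(1 / r - 1 / s)\<^sup>2 \<le> (1 + d\<^sup>2) * (1 / r ^ 2)" .
    have "1 / r - 1 / s = (s - r) / (r * s)" using that by (simp add: field_simps)
    also have "\<dots> \<le> d / (r * r)" using that by (intro frac_le mult_left_mono) auto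
    finally have "(1 / r - 1 / s)\<^sup>2 \<le> (d / (r * r))\<^sup>2"
      using \<open>1 / s \<le> 1 / r\<close> by (intro power_mono) auto
    also have "\<dots> \<le> (1 + d\<^sup>2) * (1 / r ^ 4)"
      using that by (simp add: power_divide power2_eq_square power4_eq_xxxx mult.assoc divide_right_mono)
    finally show ?thesis using 1 by (simp add: min_def)
  qed
  have nn: "0 \<le> (1 + d\<^sup>2) * min (1 / r ^ 2) (1 / r ^ 4)" for r :: real by simp
  show ?thesis
  proof (cases "p \<le> q")
    case True thus ?thesis using main[of p q] nn[of q] assms by (simp add: distrib_left add_increasing2)
  next
    case False thus ?thesis using main[of q p] nn[of p] assms
      by (simp add: distrib_left power2_commute[of "1 / p"] abs_minus_commute add_increasing)
  qed
qed

lemma coulomb_borel_measurable: "coulomb n z c \<in> borel_measurable borel"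
  unfolding coulomb_def[abs_def] by measurable

text \<open>Since the charges cancel, \<open>(\<Sum>j<n. c j) / dist x (z 0)\<close> may be
  subtracted, leaving differences controlled by \<open>inverse_diff_sq_le\<close>. The factor
  \<open>real n\<close> in \<open>G\<close> is Cauchy-Schwarz for a sum of \<open>n\<close>
  terms.\<close>

lemma coulomb_square_integrable:
  assumes "(\<Sum>j<n. c j) = 0"
  shows "integrable lborel (\<lambda>x. (norm (coulomb n z c x))\<^sup>2)"
proof -
  define \<kappa> where "\<kappa> a x = min (1 / dist x a ^ 2) (1 / dist x a ^ 4)" for a x :: "real^3"
  define D where "D j = (norm (c j))\<^sup>2 * (1 + (dist (z j) (z 0))\<^sup>2)" for j
  define G where "G x = real n * (\<Sum>j<n. D j * (\<kappa> (z j) x + \<kappa> (z 0) x))" for x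
  have "integrable lborel (\<kappa> a)" for a
    unfolding \<kappa>_def[abs_def] by (rule integrable_inverse_powers_dist)
  hence G: "integrable lborel G" unfolding G_def[abs_def]
    by (auto intro!: Bochner_Integration.integrable_sum integrable_mult_right)
  have le: "(norm (coulomb n z c x))\<^sup>2 \<le> G x" if x: "x \<noteq> z 0" "\<And>j. j < n \<Longrightarrow> x \<noteq> z j" for x
  proof -
    have "coulomb n z c x = (\<Sum>j<n. c j / of_real (dist x (z j))) - (\<Sum>j<n. c j) / of_real (dist x (z 0))"
      using assms by (simp add: coulomb_def)
    also have "\<dots> = (\<Sum>j<n. c j * of_real (1 / dist x (z j) - 1 / dist x (z 0)))"
      by (simp add: sum_subtractf sum_divide_distrib right_diff_distrib)
    finally have "norm (coulomb n z c x) \<le> (\<Sum>j<n. norm (c j * of_real (1 / dist x (z j) - 1 / dist x (z 0))))"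
      by (simp only: norm_sum)
    also have "\<dots> = (\<Sum>j<n. norm (c j) * \<bar>1 / dist x (z j) - 1 / dist x (z 0)\<bar>)"
      by (simp only: norm_mult norm_of_real)
    finally have "(norm (coulomb n z c x))\<^sup>2 \<le> (\<Sum>j<n. norm (c j) * \<bar>1 / dist x (z j) - 1 / dist x (z 0)\<bar>)\<^sup>2"
      by (intro power_mono) auto
    also have "\<dots> \<le> (\<Sum>j<n. (norm (c j) * \<bar>1 / dist x (z j) - 1 / dist x (z 0)\<bar>)\<^sup>2) * real n"
      using sum_squared_le_sum_of_squares[of _ "{..<n}"] by simp
    also have "\<dots> \<le> G x"
    proof -
      have "(norm (c j) * \<bar>1 / dist x (z j) - 1 / dist x (z 0)\<bar>)\<^sup>2 \<le> D j * (\<kappa> (z j) x + \<kappa> (z 0) x)" if "j < n" for j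
      proof -
        have "\<bar>dist x (z j) - dist x (z 0)\<bar> \<le> dist (z j) (z 0)"
          by (metis abs_dist_diff_le dist_commute)
        hence "(1 / dist x (z j) - 1 / dist x (z 0))\<^sup>2 \<le> (1 + (dist (z j) (z 0))\<^sup>2) * (\<kappa> (z j) x + \<kappa> (z 0) x)"
          unfolding \<kappa>_def using x that by (intro inverse_diff_sq_le) auto
        hence "(norm (c j))\<^sup>2 * (1 / dist x (z j) - 1 / dist x (z 0))\<^sup>2 \<le> (norm (c j))\<^sup>2 * ((1 + (dist (z j) (z 0))\<^sup>2) * (\<kappa> (z j) x + \<kappa> (z 0) x))"
          by (rule mult_left_mono) simp
        thus ?thesis by (simp only: power_mult_distrib power2_abs D_def mult.assoc)
      qed
      thus ?thesis unfolding G_def mult.commute[of _ "real n"]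
        by (intro mult_left_mono sum_mono) auto
    qed
    finally show ?thesis .
  qed
  show ?thesis
  proof (rule Bochner_Integration.integrable_bound[OF G])
    show "(\<lambda>x. (norm (coulomb n z c x))\<^sup>2) \<in> borel_measurable lborel"
      using coulomb_borel_measurable[of n z c] by measurable
    \<comment> \<open>The pointwise bound was shown off the centres only, and these form a null
      set.\<close>
    have "AE x in lborel. \<forall>j<Suc n. x \<noteq> z j"
      by (simp add: AE_all_countable AE_lborel_singleton)
    moreover have "AE x in lborel. x \<noteq> z 0" by (rule AE_lborel_singleton)
    ultimately show "AE x in lborel. norm ((norm (coulomb n z c x))\<^sup>2) \<le> norm (G x)"
      by eventually_elim (use le in \<open>force intro: order_trans[OF _ abs_ge_self]\<close>)
  qed
qed

subsection \<open>Zero-energy bound states\<close>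

text \<open>Identifies \<psi> from its poles and square integrability; the boundary conditions on
  the constant terms enter only afterwards.\<close>

lemma bound_state_eq_coulomb:
  assumes inj: "inj_on z {..<n}"
    and L2: "integrable lebesgue (\<lambda>x. (norm (\<psi> x))\<^sup>2)"
    and harm: "harmonic_on (- (z ` {..<n})) \<psi>"
    and exp: "\<And>j. j < n \<Longrightarrow> point_expansion \<psi> (z j) (c j) (b j)"
    and x: "x \<notin> z ` {..<n}"
  shows "\<psi> x = coulomb n z c x"
proof -
  define Z where "Z = z ` {..<n}"
  have Z: "finite Z" "open (- Z)" by (auto simp: Z_def intro!: open_Compl finite_imp_closed)
  define h where "h x = \<psi> x - coulomb n z c x" for x
  have harmc: "harmonic_on (- Z) (coulomb n z c)"
    using harmonic_on_coulomb_sum[of "{..<n}" z c] by (simp add: Z_def coulomb_def[abs_def])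
  have "continuous_on (- Z) h"
    unfolding h_def using harm harmc Z_def
    by (intro continuous_intros harmonic_on_continuous) auto
  moreover have "\<exists>l. (h \<longlongrightarrow> l) (at a)" if a: "a \<in> Z" for a
  proof -
    obtain j where j: "j < n" "a = z j" using a by (auto simp: Z_def)
    from tendsto_diff[OF point_expansion_tendsto[OF exp[OF j(1)]] point_expansion_tendsto[OF coulomb_expansion[OF inj j(1), of c]]]
    show ?thesis by (auto simp: j(2) h_def[abs_def])
  qed
  ultimately obtain H where H: "continuous_on UNIV H" "\<And>x. x \<notin> Z \<Longrightarrow> H x = h x"
    using removable_singularities[OF Z(1)] by metis
  have sd: "(second_difference_sum H x \<longlongrightarrow> 0) (at_right 0)" if "x \<notin> Z" for x
  proof -
    have "((\<lambda>t. second_difference_sum \<psi> x t + - second_difference_sum (coulomb n z c) x t) \<longlongrightarrow> 0 + - 0) (at_right 0)"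
      using that harm harmc Z by (intro tendsto_intros second_difference_harmonic) (auto simp: Z_def)
    moreover have "second_difference_sum \<psi> x t + - second_difference_sum (coulomb n z c) x t = second_difference_sum h x t" for t
      using second_difference_sum_linear(1)[of \<psi> "\<lambda>y. - coulomb n z c y" x t]
        second_difference_sum_linear(2)[OF bounded_linear_minus[OF bounded_linear_ident], of "coulomb n z c" x t]
      by (simp add: h_def[abs_def])
    ultimately have "(second_difference_sum h x \<longlongrightarrow> 0) (at_right 0)" by simp
    thus ?thesis
      using tendsto_cong[OF second_difference_sum_cong[OF Z(2), of x H h]] that H(2) by simp
  qed
  \<comment> \<open>The Liouville theorem is real and one-sided. Taking \<open>w\<close> among the
    four units 1, -1, \<open>\<i>\<close> and \<open>- \<i>\<close> bounds the real and imaginary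
    parts of \<open>H x\<close> from both sides.\<close>
  have nonpos: "Re (w * H x) \<le> 0" if w: "norm w = 1" for w x
  proof -
    have bl: "bounded_linear (\<lambda>v. Re (w * v))"
      by (rule bounded_linear_compose[OF bounded_linear_Re bounded_linear_mult_right])
    show ?thesis
    proof (rule punctured_liouville[OF _ Z(1)])
      show cont: "continuous_on UNIV (\<lambda>x. Re (w * H x))" by (intro continuous_intros H)
      fix y assume "y \<notin> Z"
      from tendsto_Re[OF tendsto_mult_left[OF sd[OF this], of w]]
      show "(second_difference_sum (\<lambda>x. Re (w * H x)) y \<longlongrightarrow> 0) (at_right 0)"
        by (simp add: second_difference_sum_linear(2)[OF bl, abs_def] del: times_complex.sel)
    next
      fix p q
      show "((\<lambda>x. integral (cbox p q) (\<lambda>y. Re (w * H (x + y)))) \<longlongrightarrow> 0) at_infinity"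
      proof (rule box_average_tendsto_0[OF L2])
        show "continuous_on UNIV (\<lambda>x. Re (w * H x))" by (intro continuous_intros H)
        show "((\<lambda>x. norm (coulomb n z c x)) \<longlongrightarrow> 0) at_infinity"
          by (rule tendsto_norm_zero[OF coulomb_tendsto_0])
        have "\<bar>Re (w * H x)\<bar> \<le> norm (\<psi> x) + norm (coulomb n z c x)" if "x \<notin> Z" for x
        proof -
          have "\<bar>Re (w * H x)\<bar> \<le> norm (w * H x)" by (rule abs_Re_le_cmod)
          also have "\<dots> = norm (h x)" using w H(2)[OF that] by (simp add: norm_mult)
          also have "\<dots> \<le> norm (\<psi> x) + norm (coulomb n z c x)"
            unfolding h_def by (rule norm_triangle_ineq4)
          finally show ?thesis .
        qed
        thus "\<forall>\<^sub>F x in at_infinity. \<bar>Re (w * H x)\<bar> \<le> norm (\<psi> x) + norm (coulomb n z c x)"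
          using eventually_notin_finite_at_infinity[OF Z(1)] by (auto elim: eventually_mono)
      qed
    qed
  qed
  have "H x = 0"
    using nonpos[of 1 x] nonpos[of "-1" x] nonpos[of \<i> x] nonpos[of "- \<i>" x]
    by (simp add: complex_eq_iff)
  thus ?thesis using H(2)[of x] x by (simp add: h_def Z_def)
qed

lemma zero_energy_bound_state_iff:
  "zero_energy_bound_state n z \<alpha> \<psi> \<longleftrightarrow>
     \<psi> \<in> borel_measurable lebesgue \<and> integrable lebesgue (\<lambda>x. (norm (\<psi> x))\<^sup>2) \<and>
     harmonic_on (- (z ` {..<n})) \<psi> \<and>
     (\<forall>j<n. \<exists>c. point_expansion \<psi> (z j) c (4 * of_real pi * of_real (\<alpha> j) * c))"
  unfolding zero_energy_bound_state_def point_expansion_def by simp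

text \<open>For the charges \<open>c j = - q j / (4 * pi)\<close>, row \<open>j\<close> of
  \<open>A q\<close> is the constant term of the potential at \<open>z j\<close> minus the value
  \<open>4 * pi * \<alpha> j * c j\<close> demanded by the boundary condition.\<close>

lemma A_mat_row_sum:
  fixes q :: "nat \<Rightarrow> complex"
  assumes "j < n"
  shows "(\<Sum>k<n. of_real (A_mat z \<alpha> j k) * q k) =
    (\<Sum>k\<in>{..<n} - {j}. (- q k / (4 * of_real pi)) / of_real (dist (z j) (z k)))
      - 4 * of_real pi * of_real (\<alpha> j) * (- q j / (4 * of_real pi))"
proof -
  have "(\<Sum>k<n. of_real (A_mat z \<alpha> j k) * q k) =
      of_real (\<alpha> j) * q j + (\<Sum>k\<in>{..<n} - {j}. of_real (A_mat z \<alpha> j k) * q k)"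
    using assms by (subst sum.remove[of _ j]) (auto simp: A_mat_def)
  also have "(\<Sum>k\<in>{..<n} - {j}. of_real (A_mat z \<alpha> j k) * q k) =
      (\<Sum>k\<in>{..<n} - {j}. (- q k / (4 * of_real pi)) / of_real (dist (z j) (z k)))"
    by (intro sum.cong refl) (auto simp: A_mat_def)
  finally show ?thesis by simp
qed

lemma coulomb_cong: "(\<And>j. j < n \<Longrightarrow> c j = c' j) \<Longrightarrow> coulomb n z c = coulomb n z c'"
  by (simp add: coulomb_def fun_eq_iff)

text \<open>The vanishing rows of \<open>A q\<close> supply the boundary conditions, and the
  vanishing sum of \<open>q\<close> supplies square integrability.\<close>

lemma bound_state_of_admissible:
  assumes inj: "inj_on z {..<n}" and q: "admissible_vector n z \<alpha> q"
  shows "zero_energy_bound_state n z \<alpha> (psi_of n z q)"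
proof -
  define c where "c j = - q j / (4 * of_real pi)" for j
  have psi: "psi_of n z q = coulomb n z c" unfolding c_def by (rule psi_of_eq_coulomb)
  have s: "(\<Sum>j<n. c j) = 0"
    using q by (simp add: c_def admissible_vector_def sum_negf sum_divide_distrib[symmetric])
  have "point_expansion (coulomb n z c) (z j) (c j) (4 * of_real pi * of_real (\<alpha> j) * c j)" if j: "j < n" for j
  proof -
    have "(\<Sum>k<n. of_real (A_mat z \<alpha> j k) * q k) = 0" using q j by (simp add: admissible_vector_def)
    hence "(\<Sum>k\<in>{..<n} - {j}. c k / of_real (dist (z j) (z k))) = 4 * of_real pi * of_real (\<alpha> j) * c j"
      by (simp only: A_mat_row_sum[OF j] c_def right_minus_eq)
    thus ?thesis using coulomb_expansion[OF inj j, of c] by simp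
  qed
  moreover have "integrable lebesgue (\<lambda>x. (norm (coulomb n z c x))\<^sup>2)"
    using coulomb_square_integrable[OF s, of z] coulomb_borel_measurable[of n z c]
    by (subst integrable_completion) measurable
  moreover have "coulomb n z c \<in> borel_measurable lebesgue"
    using coulomb_borel_measurable[of n z c] by (intro measurable_completion) simp
  moreover have "harmonic_on (- (z ` {..<n})) (coulomb n z c)"
    using harmonic_on_coulomb_sum[of "{..<n}" z c] by (simp add: coulomb_def[abs_def])
  ultimately show ?thesis unfolding psi zero_energy_bound_state_iff by blast
qed

text \<open>Agreement is claimed off the centres, because the definition of a bound state does not
  constrain the values of \<psi> at the points \<open>z j\<close>.\<close>

lemma admissible_of_bound_state:
  assumes inj: "inj_on z {..<n}" and \<psi>: "zero_energy_bound_state n z \<alpha> \<psi>"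
  obtains q where "\<forall>j\<ge>n. q j = 0" "admissible_vector n z \<alpha> q"
    "\<forall>x\<in>- (z ` {..<n}). \<psi> x = psi_of n z q x"
proof -
  have L2: "integrable lebesgue (\<lambda>x. (norm (\<psi> x))\<^sup>2)" and harm: "harmonic_on (- (z ` {..<n})) \<psi>"
    using \<psi> by (auto simp: zero_energy_bound_state_iff)
  obtain c where c: "\<And>j. j < n \<Longrightarrow> point_expansion \<psi> (z j) (c j) (4 * of_real pi * of_real (\<alpha> j) * c j)"
    using \<psi> unfolding zero_energy_bound_state_iff by metis
  have eq: "\<psi> x = coulomb n z c x" if "x \<notin> z ` {..<n}" for x
    by (rule bound_state_eq_coulomb[OF inj L2 harm c that])
  \<comment> \<open>Inverts \<open>c = - q / (4 * pi)\<close>; the value 0 from index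
    \<open>n\<close> on encodes a vector of length \<open>n\<close>.\<close>
  define q where "q j = (if j < n then - 4 * of_real pi * c j else 0)" for j
  have cq: "- q j / (4 * of_real pi) = c j" if "j < n" for j using that by (simp add: q_def)
  have fin: "finite (z ` {..<n})" by simp
  have "(\<Sum>j<n. c j) = 0"
    by (rule square_integrable_coulomb_sum_0[OF L2, of n z])
       (rule eventually_mono[OF eventually_notin_finite_at_infinity[OF fin] eq])
  moreover have "(\<Sum>j<n. q j) = - 4 * of_real pi * (\<Sum>j<n. c j)"
    unfolding sum_distrib_left by (intro sum.cong refl) (simp add: q_def)
  ultimately have "(\<Sum>j<n. q j) = 0" by simp
  moreover have "(\<Sum>k<n. of_real (A_mat z \<alpha> j k) * q k) = 0" if j: "j < n" for j
  proof -
    have "4 * of_real pi * of_real (\<alpha> j) * c j = (\<Sum>k\<in>{..<n} - {j}. c k / of_real (dist (z j) (z k)))"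
      by (rule point_expansion_unique(2)[OF c[OF j] coulomb_expansion[OF inj j]])
         (rule eventually_mono[OF eventually_at_notin_finite[OF fin] eq])
    also have "\<dots> = (\<Sum>k\<in>{..<n} - {j}. (- q k / (4 * of_real pi)) / of_real (dist (z j) (z k)))"
      by (intro sum.cong refl) (simp only: cq DiffD1 lessThan_iff[symmetric])
    finally show ?thesis unfolding A_mat_row_sum[OF j] cq[OF j] by simp
  qed
  ultimately have "admissible_vector n z \<alpha> q" by (simp add: admissible_vector_def)
  moreover have "psi_of n z q = coulomb n z c"
    unfolding psi_of_eq_coulomb by (rule coulomb_cong) (rule cq)
  ultimately show ?thesis using eq by (intro that[of q]) (auto simp: q_def)
qed

lemma psi_of_eq_imp_vectors_eq:
  assumes "inj_on z {..<n}" "\<And>x. x \<notin> z ` {..<n} \<Longrightarrow> psi_of n z q x = psi_of n z q' x" "j < n"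
  shows "q j = q' j"
  using coulomb_eq_imp_coeffs_eq[OF assms(1) _ assms(3), of "\<lambda>j. - q j / (4 * of_real pi)" "\<lambda>j. - q' j / (4 * of_real pi)"]
    assms(2) by (simp add: psi_of_eq_coulomb)

text \<open>Bound states are compared off the centres, so non-zero means non-zero at some point
  there. Requiring \<open>q j = 0\<close> for \<open>j \<ge> n\<close> turns functions on
  \<open>nat\<close> into vectors with \<open>n\<close> entries and makes \<open>q\<close>
  unique.\<close>

theorem theorem1:
  fixes n :: nat and z :: "nat \<Rightarrow> real^3" and \<alpha> :: "nat \<Rightarrow> real"
  assumes "n \<ge> 1" and "inj_on z {..<n}"
  shows "((\<exists>\<psi>. zero_energy_bound_state n z \<alpha> \<psi> \<and> (\<exists>x \<in> - (z ` {..<n}). \<psi> x \<noteq> 0))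
            \<longleftrightarrow> (\<exists>q. (\<exists>j<n. q j \<noteq> 0) \<and> admissible_vector n z \<alpha> q))
       \<and> (\<forall>q. admissible_vector n z \<alpha> q \<longrightarrow> zero_energy_bound_state n z \<alpha> (psi_of n z q))
       \<and> (\<forall>\<psi>. zero_energy_bound_state n z \<alpha> \<psi> \<longrightarrow>
            (\<exists>!q. (\<forall>j\<ge>n. q j = 0) \<and> admissible_vector n z \<alpha> q
                  \<and> (\<forall>x \<in> - (z ` {..<n}). \<psi> x = psi_of n z q x)))"
proof (intro conjI allI impI iffI)
  assume "\<exists>\<psi>. zero_energy_bound_state n z \<alpha> \<psi> \<and> (\<exists>x \<in> - (z ` {..<n}). \<psi> x \<noteq> 0)"
  then obtain \<psi> x where \<psi>: "zero_energy_bound_state n z \<alpha> \<psi>" and x: "x \<in> - (z ` {..<n})" "\<psi> x \<noteq> 0" by blast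
  obtain q where q: "admissible_vector n z \<alpha> q" "\<forall>x\<in>- (z ` {..<n}). \<psi> x = psi_of n z q x"
    by (rule admissible_of_bound_state[OF assms(2) \<psi>])
  hence "psi_of n z q x \<noteq> 0" using x by auto
  hence "\<exists>j<n. q j \<noteq> 0" by (auto simp: psi_of_def intro: ccontr)
  thus "\<exists>q. (\<exists>j<n. q j \<noteq> 0) \<and> admissible_vector n z \<alpha> q" using q(1) by blast
next
  assume "\<exists>q. (\<exists>j<n. q j \<noteq> 0) \<and> admissible_vector n z \<alpha> q"
  then obtain q j where q: "admissible_vector n z \<alpha> q" and j: "j < n" "q j \<noteq> 0" by blast
  have "\<exists>x \<in> - (z ` {..<n}). psi_of n z q x \<noteq> 0"
  \<comment> \<open>A potential vanishing off the centres agrees there with that of the zero vector,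
    so its poles, and with them \<open>q j\<close>, would vanish.\<close>
  proof (rule ccontr)
    assume "\<not> (\<exists>x \<in> - (z ` {..<n}). psi_of n z q x \<noteq> 0)"
    hence "psi_of n z q x = psi_of n z (\<lambda>_. 0) x" if "x \<notin> z ` {..<n}" for x
      using that by (auto simp: psi_of_def)
    from psi_of_eq_imp_vectors_eq[OF assms(2) this j(1)] j(2) show False by simp
  qed
  thus "\<exists>\<psi>. zero_energy_bound_state n z \<alpha> \<psi> \<and> (\<exists>x \<in> - (z ` {..<n}). \<psi> x \<noteq> 0)"
    using bound_state_of_admissible[OF assms(2) q] by blast
next
  fix q assume "admissible_vector n z \<alpha> q"
  thus "zero_energy_bound_state n z \<alpha> (psi_of n z q)" by (rule bound_state_of_admissible[OF assms(2)])
next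
  fix \<psi> assume \<psi>: "zero_energy_bound_state n z \<alpha> \<psi>"
  obtain q where q: "\<forall>j\<ge>n. q j = 0" "admissible_vector n z \<alpha> q" "\<forall>x\<in>- (z ` {..<n}). \<psi> x = psi_of n z q x"
    by (rule admissible_of_bound_state[OF assms(2) \<psi>])
  show "\<exists>!q. (\<forall>j\<ge>n. q j = 0) \<and> admissible_vector n z \<alpha> q \<and> (\<forall>x \<in> - (z ` {..<n}). \<psi> x = psi_of n z q x)"
  proof (rule ex1I)
    show "(\<forall>j\<ge>n. q j = 0) \<and> admissible_vector n z \<alpha> q \<and> (\<forall>x \<in> - (z ` {..<n}). \<psi> x = psi_of n z q x)"
      using q by blast
    fix q' assume q': "(\<forall>j\<ge>n. q' j = 0) \<and> admissible_vector n z \<alpha> q' \<and> (\<forall>x \<in> - (z ` {..<n}). \<psi> x = psi_of n z q' x)"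
    show "q' = q"
    proof (rule ext)
      fix j
      show "q' j = q j"
      proof (cases "j < n")
        case True
        have "psi_of n z q' x = psi_of n z q x" if "x \<notin> z ` {..<n}" for x
          using q(3) q' that by (metis ComplI)
        from psi_of_eq_imp_vectors_eq[OF assms(2) this True] show ?thesis .
      next
        case False thus ?thesis using q(1) q' by simp
      qed
    qed
  qed
qed

end
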